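(* There exists a universal constant $C>0$ such that for every $n\in\mathbb{N}$, every $1\le p<2$ and every $T\in \mathbb{M}_{2^n}$ with $0\le T\le \mathbf{1}$, $$\max_{j\in[n]}\|\mathbf{d}_{j}(T)\|^{p}_{L_{p}}\;\ge\; C\,\frac{(2-p)\,\mathrm{var}(T)\,\log(n)}{n}.$$
   Context: $n\ge 1$ is an integer, $[n]=\{1,\dots,n\}$. $\mathbb{M}_{2^n}=M_2(\mathbb{C})^{\otimes n}$ is the algebra of complex $2^n\times 2^n$ matrices with unit $\mathbf{1}$, equipped with the normalized trace $\mathrm{tr}$ (so $\mathrm{tr}(\mathbf{1})=1$). For $1\le p<\infty$, $\|T\|_{L_p}=(\mathrm{tr}(|T|^p))^{1/p}$ with $|T|=(T^*T)^{1/2}$. The variance is $\mathrm{var}(T)=\mathrm{tr}(|T|^2)-|\mathrm{tr}(T)|^2=\|T-\mathrm{tr}(T)\mathbf{1}\|_{L_2}^2$. The $j$-th partial derivative is the linear map $\mathbf{d}_j=\mathrm{id}^{\otimes(j-1)}\otimes D\otimes \mathrm{id}^{\otimes(n-j)}$ on $\mathbb{M}_{2^n}$, where $D:M_2(\mathbb{C})\to M_2(\mathbb{C})$ is $D(A)=A-\mathrm{tr}(A)\mathbf{1}_2$ ($\mathrm{tr}$ being the normalized trace on $M_2(\mathbb{C})$). The order $0\le T\le\mathbf{1}$ is the operator (Loewner) order. *)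

theory Defs
  imports "Jordan_Normal_Form.Schur_Decomposition"
begin

definition ntr :: "complex mat \<Rightarrow> complex" where
  "ntr A = (\<Sum>i<dim_row A. A $$ (i, i)) / of_nat (dim_row A)"

text \<open>Over the complex numbers, \<open>0 \<le> z\<close> forces \<open>z\<close> to be real, hence a positive
  semidefinite matrix is automatically Hermitian.\<close>

definition psd :: "complex mat \<Rightarrow> bool" where
  "psd A \<longleftrightarrow> square_mat A \<and> (\<forall>v \<in> carrier_vec (dim_row A). 0 \<le> (A *\<^sub>v v) \<bullet>c v)"

text \<open>The library order \<open>\<le>\<close> on type \<open>mat\<close> is entrywise, so the Loewner order needs its own name.\<close>

definition loewner_le :: "complex mat \<Rightarrow> complex mat \<Rightarrow> bool" where
  "loewner_le A B \<longleftrightarrow> dim_row A = dim_row B \<and> dim_col A = dim_col B \<and> psd (B - A)"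

definition unitarily_diagonalizes :: "complex mat \<Rightarrow> (nat \<Rightarrow> real) \<Rightarrow> complex mat \<Rightarrow> bool" where
  "unitarily_diagonalizes U d A \<longleftrightarrow>
     A \<in> carrier_mat (dim_row A) (dim_row A) \<and> U \<in> carrier_mat (dim_row A) (dim_row A) \<and>
     U * mat_adjoint U = 1\<^sub>m (dim_row A) \<and> mat_adjoint U * U = 1\<^sub>m (dim_row A) \<and>
     A = U * mat_diag (dim_row A) (\<lambda>i. complex_of_real (d i)) * mat_adjoint U"

text \<open>\<open>herm_fun f A\<close> is \<open>f(A)\<close> for Hermitian \<open>A\<close>. The value does not depend on the chosen
  diagonalization, see \<open>herm_fun_eq\<close> below; one exists by the spectral theorem.\<close>

definition herm_fun :: "(real \<Rightarrow> real) \<Rightarrow> complex mat \<Rightarrow> complex mat" where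
  "herm_fun f A = (THE B. \<exists>U d. unitarily_diagonalizes U d A \<and>
     B = U * mat_diag (dim_row A) (\<lambda>i. complex_of_real (f (d i))) * mat_adjoint U)"

definition mat_abs :: "complex mat \<Rightarrow> complex mat" where
  "mat_abs T = herm_fun sqrt (mat_adjoint T * T)"

definition Lp_norm :: "real \<Rightarrow> complex mat \<Rightarrow> real" where
  "Lp_norm p T = Re (ntr (herm_fun (\<lambda>x. x powr p) (mat_abs T))) powr (1 / p)"

definition mat_var :: "complex mat \<Rightarrow> real" where
  "mat_var T = Re (ntr (mat_abs T ^\<^sub>m 2)) - (cmod (ntr T))\<^sup>2"

text \<open>Kronecker product; it identifies the tensor product of the \<open>a \<times> a\<close> and the \<open>b \<times> b\<close> matrices
  with the \<open>a b \<times> a b\<close> matrices, and the \<open>n\<close>-fold tensor power of the \<open>2 \<times> 2\<close> matrices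
  with the \<open>2^n \<times> 2^n\<close> matrices.\<close>

definition kron :: "complex mat \<Rightarrow> complex mat \<Rightarrow> complex mat" where
  "kron A B = mat (dim_row A * dim_row B) (dim_col A * dim_col B)
     (\<lambda>(r, s). A $$ (r div dim_row B, s div dim_col B) * B $$ (r mod dim_row B, s mod dim_col B))"

definition mat_unit :: "nat \<Rightarrow> nat \<Rightarrow> nat \<Rightarrow> complex mat" where
  "mat_unit m i j = mat m m (\<lambda>(r, s). if r = i \<and> s = j then 1 else 0)"

text \<open>The tensor product of linear maps \<open>\<Phi>\<close> on the \<open>a \<times> a\<close> and \<open>\<Psi>\<close> on the \<open>b \<times> b\<close> matrices:
  expand \<open>T\<close> in the basis \<open>E\<^sub>i\<^sub>j \<otimes> E\<^sub>k\<^sub>l\<close> (whose coefficient is \<open>T $$ (i * b + k, j * b + l)\<close>)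
  and replace each basis element by \<open>\<Phi> E\<^sub>i\<^sub>j \<otimes> \<Psi> E\<^sub>k\<^sub>l\<close>. The sum of matrices is written
  entrywise. See \<open>tensor_map_kron\<close> for the characteristic property.\<close>

definition tensor_map ::
  "nat \<Rightarrow> nat \<Rightarrow> (complex mat \<Rightarrow> complex mat) \<Rightarrow> (complex mat \<Rightarrow> complex mat)
    \<Rightarrow> complex mat \<Rightarrow> complex mat" where
  "tensor_map a b \<Phi> \<Psi> T = mat (a * b) (a * b) (\<lambda>(r, s).
     \<Sum>i<a. \<Sum>j<a. \<Sum>k<b. \<Sum>l<b. T $$ (i * b + k, j * b + l) *
       kron (\<Phi> (mat_unit a i j)) (\<Psi> (mat_unit b k l)) $$ (r, s))"

definition D_map :: "complex mat \<Rightarrow> complex mat" where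
  "D_map A = A - ntr A \<cdot>\<^sub>m 1\<^sub>m 2"

text \<open>\<open>id\<close> on the first \<open>j - 1\<close> and the last \<open>n - j\<close> tensor factors, \<open>D_map\<close> on the \<open>j\<close>-th
  (for \<open>1 \<le> j \<le> n\<close>).\<close>

definition partial_d :: "nat \<Rightarrow> nat \<Rightarrow> complex mat \<Rightarrow> complex mat" where
  "partial_d n j =
     tensor_map (2 ^ (j - 1) * 2) (2 ^ (n - j)) (tensor_map (2 ^ (j - 1)) 2 id D_map) id"

lemma adjoint_carrier: "A \<in> carrier_mat m n \<Longrightarrow> mat_adjoint A \<in> carrier_mat n m"
  unfolding mat_adjoint_def mat_of_rows_def by auto

lemma herm_fun_unique:
  assumes U: "unitarily_diagonalizes U d A" and V: "unitarily_diagonalizes V e A"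
  shows "U * mat_diag (dim_row A) (\<lambda>i. complex_of_real (f (d i))) * mat_adjoint U =
         V * mat_diag (dim_row A) (\<lambda>i. complex_of_real (f (e i))) * mat_adjoint V"
proof -
  define n where "n = dim_row A"
  define US VS where "US = mat_adjoint U" and "VS = mat_adjoint V"
  define D E where "D = mat_diag n (\<lambda>i. complex_of_real (d i))"
    and "E = mat_diag n (\<lambda>i. complex_of_real (e i))"
  define FD FE where "FD = mat_diag n (\<lambda>i. complex_of_real (f (d i)))"
    and "FE = mat_diag n (\<lambda>i. complex_of_real (f (e i)))"
  note defs = n_def[symmetric] US_def[symmetric] VS_def[symmetric]
  have c[simp]: "U \<in> carrier_mat n n" "V \<in> carrier_mat n n" "D \<in> carrier_mat n n"
      "E \<in> carrier_mat n n" "FD \<in> carrier_mat n n" "FE \<in> carrier_mat n n"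
    using U V unfolding unitarily_diagonalizes_def D_def E_def FD_def FE_def n_def by auto
  have c'[simp]: "US \<in> carrier_mat n n" "VS \<in> carrier_mat n n"
    unfolding US_def VS_def by (auto intro: adjoint_carrier)
  have UU: "U * US = 1\<^sub>m n" "US * U = 1\<^sub>m n" and VV: "V * VS = 1\<^sub>m n" "VS * V = 1\<^sub>m n"
    and AU: "A = U * D * US" and AV: "A = V * E * VS"
    using U V unfolding unitarily_diagonalizes_def D_def E_def defs by auto
  define W where "W = VS * U"
  have W[simp]: "W \<in> carrier_mat n n" unfolding W_def by (rule mult_carrier_mat[of _ _ n]) auto
  have assoc: "X * Y * Z = X * (Y * Z)"
    if "X \<in> carrier_mat n n" "Y \<in> carrier_mat n n" "Z \<in> carrier_mat n n" for X Y Z :: "complex mat"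
    using that by (rule assoc_mult_mat)
  have mc: "X * Y \<in> carrier_mat n n"
    if "X \<in> carrier_mat n n" "Y \<in> carrier_mat n n" for X Y :: "complex mat"
    using that by (rule mult_carrier_mat)
  have can: "X * (Y * Z) = Z" if "X * Y = 1\<^sub>m n" "X \<in> carrier_mat n n" "Y \<in> carrier_mat n n"
    "Z \<in> carrier_mat n n" for X Y Z :: "complex mat"
    using assoc[of X Y Z] that by (metis left_mult_one_mat)
  have "W * D = VS * (U * D * US) * U"
    by (simp add: W_def assoc mc UU right_mult_one_mat[of D n n])
  also have "\<dots> = VS * (V * E * VS) * U" using AU AV by simp
  also have "\<dots> = E * W" by (simp add: W_def assoc mc can VV)
  finally have WD: "W * D = E * W" .
  have "W * FD = FE * W"
  proof (rule eq_matI)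
    fix i j assume "i < dim_row (FE * W)" "j < dim_col (FE * W)"
    then have ij: "i < n" "j < n" using W c by auto
    have L: "(W * D) $$ (i, j) = W $$ (i, j) * d j" "(E * W) $$ (i, j) = e i * W $$ (i, j)"
      "(W * FD) $$ (i, j) = W $$ (i, j) * f (d j)" "(FE * W) $$ (i, j) = f (e i) * W $$ (i, j)"
      using ij unfolding D_def E_def FD_def FE_def
      by (subst mat_diag_mult_right[OF W] mat_diag_mult_left[OF W]; simp)+
    have "W $$ (i, j) = 0 \<or> d j = e i"
      using L(1,2) WD by (metis mult.commute mult_cancel_right of_real_eq_iff)
    then show "(W * FD) $$ (i, j) = (FE * W) $$ (i, j)" using L(3,4) by auto
  qed (simp_all add: carrier_matD[OF W] carrier_matD[OF c(5)] carrier_matD[OF c(6)])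
  then have "V * (W * FD) * US = V * (FE * W) * US" by simp
  moreover have "V * (W * FD) * US = U * FD * US"
    by (simp add: W_def assoc mc can VV)
  moreover have "V * (FE * W) * US = V * FE * VS"
    by (simp add: W_def assoc mc UU right_mult_one_mat[of VS n n])
  ultimately show ?thesis unfolding FD_def FE_def defs by simp
qed

lemma herm_fun_eq:
  assumes "unitarily_diagonalizes U d A"
  shows "herm_fun f A =
    U * mat_diag (dim_row A) (\<lambda>i. complex_of_real (f (d i))) * mat_adjoint U"
  unfolding herm_fun_def using assms herm_fun_unique[of _ _ A] by (intro the_equality) blast+

definition lin_on :: "nat \<Rightarrow> (complex mat \<Rightarrow> complex mat) \<Rightarrow> bool" where
  "lin_on m \<Phi> \<longleftrightarrow> \<Phi> ` carrier_mat m m \<subseteq> carrier_mat m m \<and>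
     (\<forall>A \<in> carrier_mat m m. \<forall>B \<in> carrier_mat m m. \<Phi> (A + B) = \<Phi> A + \<Phi> B) \<and>
     (\<forall>c. \<forall>A \<in> carrier_mat m m. \<Phi> (c \<cdot>\<^sub>m A) = c \<cdot>\<^sub>m \<Phi> A)"

lemma lin_on_expand:
  assumes lin: "lin_on m \<Phi>" and A: "A \<in> carrier_mat m m" and rs: "r < m" "s < m"
  shows "\<Phi> A $$ (r, s) = (\<Sum>i<m. \<Sum>j<m. A $$ (i, j) * \<Phi> (mat_unit m i j) $$ (r, s))"
proof -
  define P where "P S = mat m m (\<lambda>x. if x \<in> S then A $$ x else 0)" for S
  have Pc[simp]: "P S \<in> carrier_mat m m" for S unfolding P_def by auto
  have uc[simp]: "mat_unit m i j \<in> carrier_mat m m" for i j unfolding mat_unit_def by auto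
  have \<Phi>c: "\<Phi> X \<in> carrier_mat m m" if "X \<in> carrier_mat m m" for X
    using lin that unfolding lin_on_def by auto
  have ind: "\<Phi> (P S) $$ (r, s) = (\<Sum>x\<in>S. A $$ x * \<Phi> (mat_unit m (fst x) (snd x)) $$ (r, s))"
    if "finite S" "S \<subseteq> {..<m} \<times> {..<m}" for S
    using that
  proof (induction S rule: finite_induct)
    case empty
    have "P {} = 0 \<cdot>\<^sub>m P {}" unfolding P_def by auto
    then have "\<Phi> (P {}) = 0 \<cdot>\<^sub>m \<Phi> (P {})" using lin Pc unfolding lin_on_def by metis
    then have "\<Phi> (P {}) $$ (r, s) = (0 \<cdot>\<^sub>m \<Phi> (P {})) $$ (r, s)" by simp
    then show ?case using rs \<Phi>c[OF Pc, of "{}"] by simp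
  next
    case (insert x S)
    have "P (insert x S) = A $$ x \<cdot>\<^sub>m mat_unit m (fst x) (snd x) + P S"
      using insert.hyps insert.prems unfolding P_def mat_unit_def
      by (intro eq_matI) (auto simp: prod_eq_iff split: prod.splits)
    then have "\<Phi> (P (insert x S)) = A $$ x \<cdot>\<^sub>m \<Phi> (mat_unit m (fst x) (snd x)) + \<Phi> (P S)"
      using lin unfolding lin_on_def by simp
    then show ?case
      using insert rs \<Phi>c[OF Pc, of S] \<Phi>c[OF uc, of "fst x" "snd x"] by simp
  qed
  have "P ({..<m} \<times> {..<m}) = A" unfolding P_def using A by (intro eq_matI) auto
  with ind[of "{..<m} \<times> {..<m}"] show ?thesis
    by (simp add: sum.cartesian_product case_prod_unfold)
qed

lemma div_mod_block:
  fixes i k b :: nat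
  assumes "k < b" shows "(i * b + k) div b = i" "(i * b + k) mod b = k"
  using assms by auto

lemma tensor_map_kron:
  assumes lin: "lin_on a \<Phi>" "lin_on b \<Psi>"
    and A: "A \<in> carrier_mat a a" and B: "B \<in> carrier_mat b b"
  shows "tensor_map a b \<Phi> \<Psi> (kron A B) = kron (\<Phi> A) (\<Psi> B)"
proof -
  have \<Phi>c: "\<Phi> X \<in> carrier_mat a a" if "X \<in> carrier_mat a a" for X
    using lin that unfolding lin_on_def by auto
  have \<Psi>c: "\<Psi> X \<in> carrier_mat b b" if "X \<in> carrier_mat b b" for X
    using lin that unfolding lin_on_def by auto
  have uc: "mat_unit m i j \<in> carrier_mat m m" for m i j unfolding mat_unit_def by auto
  have ib: "i * b + k < a * b" if "i < a" "k < b" for i k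
  proof -
    have "i * b + k < Suc i * b" using that by simp
    also have "\<dots> \<le> a * b" using that by (intro mult_le_mono1) auto
    finally show ?thesis .
  qed
  have kc: "kron X Y $$ (r, s) = X $$ (r div b, s div b) * Y $$ (r mod b, s mod b)"
    if "X \<in> carrier_mat a a" "Y \<in> carrier_mat b b" "r < a * b" "s < a * b" for X Y r s
    using that unfolding kron_def by auto
  show ?thesis
  proof (rule eq_matI)
    fix r s assume "r < dim_row (kron (\<Phi> A) (\<Psi> B))" "s < dim_col (kron (\<Phi> A) (\<Psi> B))"
    then have rs: "r < a * b" "s < a * b"
      using \<Phi>c[OF A] \<Psi>c[OF B] unfolding kron_def by auto
    then have b0: "b > 0" by (cases b) auto
    have dm: "r div b < a" "s div b < a" "r mod b < b" "s mod b < b"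
      using rs b0 by (auto simp: less_mult_imp_div_less)
    have "tensor_map a b \<Phi> \<Psi> (kron A B) $$ (r, s) =
      (\<Sum>i<a. \<Sum>j<a. \<Sum>k<b. \<Sum>l<b. kron A B $$ (i * b + k, j * b + l) *
       kron (\<Phi> (mat_unit a i j)) (\<Psi> (mat_unit b k l)) $$ (r, s))"
      using rs unfolding tensor_map_def by simp
    also have "\<dots> = (\<Sum>i<a. \<Sum>j<a. \<Sum>k<b. \<Sum>l<b.
       (A $$ (i, j) * \<Phi> (mat_unit a i j) $$ (r div b, s div b)) *
       (B $$ (k, l) * \<Psi> (mat_unit b k l) $$ (r mod b, s mod b)))"
    proof (intro sum.cong refl)
      fix i j k l assume *: "i \<in> {..<a}" "j \<in> {..<a}" "k \<in> {..<b}" "l \<in> {..<b}"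
      have "kron A B $$ (i * b + k, j * b + l) = A $$ (i, j) * B $$ (k, l)"
        using * by (subst kc[OF A B]) (auto simp: ib div_mod_block)
      then show "kron A B $$ (i * b + k, j * b + l) *
        kron (\<Phi> (mat_unit a i j)) (\<Psi> (mat_unit b k l)) $$ (r, s) =
        A $$ (i, j) * \<Phi> (mat_unit a i j) $$ (r div b, s div b) *
       (B $$ (k, l) * \<Psi> (mat_unit b k l) $$ (r mod b, s mod b))"
        using rs by (simp add: kc \<Phi>c \<Psi>c uc)
    qed
    also have "\<dots> = (\<Sum>i<a. \<Sum>j<a. A $$ (i, j) * \<Phi> (mat_unit a i j) $$ (r div b, s div b)) *
       (\<Sum>k<b. \<Sum>l<b. B $$ (k, l) * \<Psi> (mat_unit b k l) $$ (r mod b, s mod b))"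
      unfolding sum_distrib_right by (simp only: sum_distrib_left)
    also have "\<dots> = \<Phi> A $$ (r div b, s div b) * \<Psi> B $$ (r mod b, s mod b)"
      using lin_on_expand[OF lin(1) A dm(1,2)] lin_on_expand[OF lin(2) B dm(3,4)] by simp
    finally show "tensor_map a b \<Phi> \<Psi> (kron A B) $$ (r, s) = kron (\<Phi> A) (\<Psi> B) $$ (r, s)"
      using rs by (simp add: kc \<Phi>c \<Psi>c A B)
  qed (use \<Phi>c[OF A] \<Psi>c[OF B] in \<open>auto simp: kron_def tensor_map_def\<close>)
qed

lemma lin_on_id: "lin_on m id"
  unfolding lin_on_def by auto

lemma lin_on_D_map: "lin_on 2 D_map"
  unfolding lin_on_def
proof (intro conjI ballI allI)
  show "D_map ` carrier_mat 2 2 \<subseteq> carrier_mat 2 2" unfolding D_map_def by auto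
next
  fix A B :: "complex mat" assume c: "A \<in> carrier_mat 2 2" "B \<in> carrier_mat 2 2"
  then have "ntr (A + B) = ntr A + ntr B"
    unfolding ntr_def by (auto simp: sum.distrib add_divide_distrib)
  then show "D_map (A + B) = D_map A + D_map B"
    using c unfolding D_map_def by (intro eq_matI) (auto simp: algebra_simps)
next
  fix c :: complex and A :: "complex mat" assume A: "A \<in> carrier_mat 2 2"
  then have "ntr (c \<cdot>\<^sub>m A) = c * ntr A"
    unfolding ntr_def by (auto simp: sum_distrib_left)
  then show "D_map (c \<cdot>\<^sub>m A) = c \<cdot>\<^sub>m D_map A"
    using A unfolding D_map_def by (intro eq_matI) (auto simp: algebra_simps)
qed

lemma lin_on_tensor_map: "lin_on (a * b) (tensor_map a b \<Phi> \<Psi>)"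
proof -
  have ib: "i * b + k < a * b" if "i < a" "k < b" for i k
  proof -
    have "i * b + k < Suc i * b" using that by simp
    also have "\<dots> \<le> a * b" using that by (intro mult_le_mono1) auto
    finally show ?thesis .
  qed
  show ?thesis
    unfolding lin_on_def
  proof (intro conjI ballI allI)
    show "tensor_map a b \<Phi> \<Psi> ` carrier_mat (a * b) (a * b) \<subseteq> carrier_mat (a * b) (a * b)"
      unfolding tensor_map_def by auto
  next
    fix A B :: "complex mat" assume "A \<in> carrier_mat (a * b) (a * b)" "B \<in> carrier_mat (a * b) (a * b)"
    then show "tensor_map a b \<Phi> \<Psi> (A + B) = tensor_map a b \<Phi> \<Psi> A + tensor_map a b \<Phi> \<Psi> B"
      unfolding tensor_map_def
      by (intro eq_matI) (auto simp: ib distrib_right sum.distrib)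
  next
    fix c :: complex and A :: "complex mat" assume "A \<in> carrier_mat (a * b) (a * b)"
    then show "tensor_map a b \<Phi> \<Psi> (c \<cdot>\<^sub>m A) = c \<cdot>\<^sub>m tensor_map a b \<Phi> \<Psi> A"
      unfolding tensor_map_def
      by (intro eq_matI) (auto simp: ib sum_distrib_left mult.assoc)
  qed
qed

lemma partial_d_kron:
  assumes "A \<in> carrier_mat (2 ^ (j - 1)) (2 ^ (j - 1))" "B \<in> carrier_mat 2 2"
    "C \<in> carrier_mat (2 ^ (n - j)) (2 ^ (n - j))"
  shows "partial_d n j (kron (kron A B) C) = kron (kron A (D_map B)) C"
proof -
  have "kron A B \<in> carrier_mat (2 ^ (j - 1) * 2) (2 ^ (j - 1) * 2)"
    using assms unfolding kron_def by auto
  then show ?thesis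
    unfolding partial_d_def
    by (simp del: One_nat_def add: tensor_map_kron[OF lin_on_tensor_map lin_on_id _ assms(3)]
        tensor_map_kron[OF lin_on_id lin_on_D_map assms(1,2)])
qed

end

theory Submission
  imports Defs "Jordan_Normal_Form.Spectral_Radius" "HOL-Analysis.L2_Norm" "HOL-Analysis.Convex"
begin

text \<open>The proof follows the semigroup proof of the Kahn--Kalai--Linial theorem, with the characters of
  the discrete cube replaced by Pauli strings. The tensor products of \<open>1, X, Y, Z\<close> form an
  orthonormal basis of the matrices on \<open>n\<close> qubits; call the number of factors different from \<open>1\<close>
  the weight of such a string and let \<open>W\<^sub>k(T)\<close> be the squared mass of \<open>T\<close> on the strings of weight
  \<open>k\<close>. Then \<open>var(T)\<close> is the sum of \<open>W\<^sub>k(T)\<close> over \<open>k \<ge> 1\<close>, and the \<open>j\<close>-th derivative keeps exactly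
  the strings whose \<open>j\<close>-th factor is not \<open>1\<close>. A string of weight \<open>k\<close> therefore survives in \<open>k\<close> of
  the derivatives, which yields \<open>sum_energy_bit_deriv\<close>: summing \<open>\<phi>(k) W\<^sub>k\<close> over all derivatives of
  \<open>T\<close> gives the sum of \<open>k \<phi>(k) W\<^sub>k(T)\<close>.

  Let \<open>M\<close> be the maximum of the \<open>p\<close>-th powers of the norms of the derivatives, and let
  \<open>q = max p (4/3)\<close>. Since \<open>0 \<le> T \<le> 1\<close>, each derivative is Hermitian with spectrum in \<open>[-1, 1]\<close>
  (\<open>norm_qform_bit_deriv_le\<close>), so raising the exponent only decreases powers of its eigenvalues.
  This gives two estimates, collected in \<open>partial_d_bounds\<close>. First, the squared 2-norm of each
  derivative is at most \<open>M\<close>, so the sum of \<open>k W\<^sub>k(T)\<close> is at most \<open>n M\<close>; this controls high weights.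
  Second, hypercontractivity in the form \<open>energy_le_Lq\<close> bounds the energy of each derivative, damped
  by \<open>5\<^sup>-\<^sup>k\<close> at weight \<open>k\<close>, by its squared \<open>q\<close>-norm, hence by \<open>M\<^bsup>2/q\<^esup>\<close>. So the sum of
  \<open>k 5\<^sup>-\<^sup>k W\<^sub>k(T)\<close> is at most \<open>n M\<^bsup>2/q\<^esup>\<close>, which controls low weights and has an exponent above one.
  Splitting at weight \<open>K\<close>, the variance is at most \<open>5\<^sup>K n M\<^bsup>2/q\<^esup> + n M / K\<close>.

  If \<open>M \<ge> n\<^bsup>-1/2\<^esup>\<close> the theorem is immediate. Otherwise the surplus factor \<open>M\<^bsup>2/q - 1\<^esup>\<close> is at most
  \<open>n\<^bsup>-(2-q)/4\<^esup>\<close>, which absorbs \<open>5\<^sup>K\<close> for \<open>K\<close> a small multiple of \<open>(2 - q) ln n\<close>, and what remains is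
  \<open>var(T) \<le> 24 n M / ((2 - q) ln n)\<close> (\<open>dichotomy_bound\<close>).

  The analytic core is \<open>hypercontractivity\<close>, a bound for the 4-norm of a damped Hermitian matrix by
  its 2-norm. Induction on the number of qubits reduces it to a scalar inequality, because the square
  of \<open>A \<otimes> 1 + B \<otimes> X + C \<otimes> Y + D \<otimes> Z\<close> again has explicit Pauli components, each a sum of products
  of two of \<open>A, B, C, D\<close>, and the 2-norm of such a product is controlled by the two 4-norms
  (\<open>frob_mprod_le\<close>). The bound for \<open>q\<close>-norms follows by duality, with Hoelder's inequality applied
  to the eigenvalues in an eigenbasis of the undamped matrix.\<close>

unbundle no inner_syntax

section \<open>Pauli components of a matrix on several qubits\<close>

text \<open>Entry functions instead of matrices: only the indices below \<open>2^n\<close> count, and since the Pauli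
  components below split off the lowest bit of both indices (the last tensor factor), their
  definition does not mention \<open>n\<close>, which keeps inductions on \<open>n\<close> free of dimension bookkeeping.\<close>

type_synonym entries = "nat \<Rightarrow> nat \<Rightarrow> complex"

definition pauli_I :: "entries \<Rightarrow> entries" where
  "pauli_I f i j = (f (2 * i) (2 * j) + f (Suc (2 * i)) (Suc (2 * j))) / 2"
definition pauli_X :: "entries \<Rightarrow> entries" where
  "pauli_X f i j = (f (2 * i) (Suc (2 * j)) + f (Suc (2 * i)) (2 * j)) / 2"
definition pauli_Y :: "entries \<Rightarrow> entries" where
  "pauli_Y f i j = \<i> * (f (2 * i) (Suc (2 * j)) - f (Suc (2 * i)) (2 * j)) / 2"
definition pauli_Z :: "entries \<Rightarrow> entries" where
  "pauli_Z f i j = (f (2 * i) (2 * j) - f (Suc (2 * i)) (Suc (2 * j))) / 2"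

lemmas pauli_defs = pauli_I_def pauli_X_def pauli_Y_def pauli_Z_def

text \<open>The entries of \<open>a \<otimes> 1 + x \<otimes> X + y \<otimes> Y + z \<otimes> Z\<close>.\<close>

definition glue :: "entries \<Rightarrow> entries \<Rightarrow> entries \<Rightarrow> entries \<Rightarrow> entries" where
  "glue a x y z r s = (let i = r div 2; j = s div 2 in
     if even r then (if even s then a i j + z i j else x i j - \<i> * y i j)
     else (if even s then x i j + \<i> * y i j else a i j - z i j))"

lemma pauli_glue [simp]:
  "pauli_I (glue a x y z) = a" "pauli_X (glue a x y z) = x"
  "pauli_Y (glue a x y z) = y" "pauli_Z (glue a x y z) = z"
  by (simp_all add: fun_eq_iff pauli_defs glue_def Let_def algebra_simps)

lemma from_pauli:
  "f (2 * i) (2 * j) = pauli_I f i j + pauli_Z f i j"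
  "f (2 * i) (Suc (2 * j)) = pauli_X f i j - \<i> * pauli_Y f i j"
  "f (Suc (2 * i)) (2 * j) = pauli_X f i j + \<i> * pauli_Y f i j"
  "f (Suc (2 * i)) (Suc (2 * j)) = pauli_I f i j - pauli_Z f i j"
  by (simp_all add: pauli_defs field_simps)

text \<open>The inner product \<open>tr(g\<^sup>* f)\<close> for the normalized trace; \<open>frob\<close> below is the square of its norm.\<close>

definition ip :: "nat \<Rightarrow> entries \<Rightarrow> entries \<Rightarrow> complex" where
  "ip n f g = (\<Sum>i<2^n. \<Sum>j<2^n. f i j * cnj (g i j)) / 2^n"

definition frob :: "nat \<Rightarrow> entries \<Rightarrow> real" where
  "frob n f = (\<Sum>i<2^n. \<Sum>j<2^n. (cmod (f i j))\<^sup>2) / 2^n"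

definition entries_tr :: "nat \<Rightarrow> entries \<Rightarrow> complex" where
  "entries_tr n f = (\<Sum>i<2^n. f i i) / 2^n"

definition mprod :: "nat \<Rightarrow> entries \<Rightarrow> entries \<Rightarrow> entries" where
  "mprod n f g i j = (\<Sum>k<2^n. f i k * g k j)"

definition herm :: "nat \<Rightarrow> entries \<Rightarrow> bool" where
  "herm n f \<longleftrightarrow> (\<forall>i<2^n. \<forall>j<2^n. f j i = cnj (f i j))"

lemma hermD: "herm n f \<Longrightarrow> i < 2 ^ n \<Longrightarrow> j < 2 ^ n \<Longrightarrow> cnj (f i j) = f j i"
  unfolding herm_def by metis

lemma hermI: "(\<And>i j. i < 2 ^ n \<Longrightarrow> j < 2 ^ n \<Longrightarrow> cnj (f i j) = f j i) \<Longrightarrow> herm n f"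
  unfolding herm_def by metis

lemma sum_even_odd: "(\<Sum>i<2 * m. g i) = (\<Sum>i<m. g (2 * i) + g (Suc (2 * i)))"
  for g :: "nat \<Rightarrow> 'a::comm_monoid_add"
  by (induction m) (simp_all add: algebra_simps)

lemma frob_ip: "complex_of_real (frob n f) = ip n f f"
  by (simp add: frob_def ip_def complex_norm_square [symmetric])

text \<open>The Pauli matrices are orthonormal for the normalized trace on one qubit.\<close>

lemma ip_Suc: "ip (Suc n) f g =
    ip n (pauli_I f) (pauli_I g) + ip n (pauli_X f) (pauli_X g) + ip n (pauli_Y f) (pauli_Y g) + ip n (pauli_Z f) (pauli_Z g)"
proof -
  have "(\<Sum>i<2 ^ Suc n. \<Sum>j<2 ^ Suc n. f i j * cnj (g i j)) =
    (\<Sum>i<2^n. \<Sum>j<2^n. 2 * (pauli_I f i j * cnj (pauli_I g i j) + pauli_X f i j * cnj (pauli_X g i j)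
        + pauli_Y f i j * cnj (pauli_Y g i j) + pauli_Z f i j * cnj (pauli_Z g i j)))"
    unfolding power_Suc sum_even_odd sum.distrib[symmetric]
    by (intro sum.cong refl, simp only: from_pauli[of f] from_pauli[of g]) (simp add: algebra_simps)
  then show ?thesis
    unfolding ip_def by (simp add: sum.distrib sum_distrib_left[symmetric] field_simps)
qed

lemma frob_Suc: "frob (Suc n) f = frob n (pauli_I f) + frob n (pauli_X f) + frob n (pauli_Y f) + frob n (pauli_Z f)"
proof -
  have "complex_of_real (frob (Suc n) f) =
      of_real (frob n (pauli_I f) + frob n (pauli_X f) + frob n (pauli_Y f) + frob n (pauli_Z f))"
    by (simp add: frob_ip ip_Suc)
  then show ?thesis by (simp only: of_real_eq_iff)
qed

lemma frob_nonneg [simp]: "0 \<le> frob n f"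
  unfolding frob_def by (intro divide_nonneg_nonneg sum_nonneg) auto

lemma frob_scale: "frob n (\<lambda>i j. c * f i j) = (cmod c)\<^sup>2 * frob n f"
  unfolding frob_def
  by (simp add: norm_mult power_mult_distrib sum_distrib_left sum_divide_distrib)

lemma sqrt_frob_L2: "sqrt (frob n f) =
    L2_set (\<lambda>(i, j). cmod (f i j)) ({..<2^n} \<times> {..<2^n}) / sqrt (2^n)"
  unfolding frob_def L2_set_def
  by (simp add: sum.cartesian_product case_prod_unfold real_sqrt_divide)

lemma sqrt_frob_triangle: "sqrt (frob n (\<lambda>i j. f i j + g i j)) \<le> sqrt (frob n f) + sqrt (frob n g)"
proof -
  let ?S = "{..<2^n} \<times> {..<2^n} :: (nat \<times> nat) set"
  have "L2_set (\<lambda>(i, j). cmod (f i j + g i j)) ?S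
      \<le> L2_set (\<lambda>p. (\<lambda>(i, j). cmod (f i j)) p + (\<lambda>(i, j). cmod (g i j)) p) ?S"
    by (intro L2_set_mono) (auto intro: norm_triangle_ineq)
  also have "\<dots> \<le> L2_set (\<lambda>(i, j). cmod (f i j)) ?S + L2_set (\<lambda>(i, j). cmod (g i j)) ?S"
    by (rule L2_set_triangle_ineq)
  finally show ?thesis
    unfolding sqrt_frob_L2 add_divide_distrib[symmetric] by (intro divide_right_mono) auto
qed

lemma ip_Cauchy_Schwarz: "cmod (ip n f g) \<le> sqrt (frob n f) * sqrt (frob n g)"
proof -
  let ?S = "{..<2^n} \<times> {..<2^n} :: (nat \<times> nat) set"
  have "cmod (\<Sum>i<2^n. \<Sum>j<2^n. f i j * cnj (g i j)) = cmod (\<Sum>(i,j)\<in>?S. f i j * cnj (g i j))"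
    by (simp add: sum.cartesian_product)
  also have "\<dots> \<le> (\<Sum>p\<in>?S. \<bar>(\<lambda>(i, j). cmod (f i j)) p\<bar> * \<bar>(\<lambda>(i, j). cmod (g i j)) p\<bar>)"
    by (intro sum_norm_le) (auto simp: norm_mult)
  also have "\<dots> \<le> L2_set (\<lambda>(i, j). cmod (f i j)) ?S * L2_set (\<lambda>(i, j). cmod (g i j)) ?S"
    by (rule L2_set_mult_ineq)
  finally show ?thesis
    unfolding sqrt_frob_L2 ip_def by (simp add: norm_divide norm_power divide_right_mono)
qed

lemma frob_add4_le: "frob n (\<lambda>i j. a i j + b i j + c i j + d i j) \<le>
    4 * (frob n a + frob n b + frob n c + frob n d)"
proof -
  have *: "(cmod (w + x + y + z))\<^sup>2 \<le> 4 * ((cmod w)\<^sup>2 + (cmod x)\<^sup>2 + (cmod y)\<^sup>2 + (cmod z)\<^sup>2)"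
    for w x y z
  proof -
    have "cmod (w + x + y + z) \<le> cmod w + cmod x + cmod y + cmod z"
      by (meson add_right_mono norm_triangle_ineq order_trans)
    then have "(cmod (w + x + y + z))\<^sup>2 \<le> (cmod w + cmod x + cmod y + cmod z)\<^sup>2"
      by (intro power_mono) auto
    also have "\<dots> \<le> 4 * ((cmod w)\<^sup>2 + (cmod x)\<^sup>2 + (cmod y)\<^sup>2 + (cmod z)\<^sup>2)"
    proof -
      have "0 \<le> (p - q)\<^sup>2 + (p - r)\<^sup>2 + (p - s)\<^sup>2 + (q - r)\<^sup>2 + (q - s)\<^sup>2 + (r - s)\<^sup>2"
        for p q r s :: real by simp
      from this[of "cmod w" "cmod x" "cmod y" "cmod z"] show ?thesis
        by (simp add: power2_eq_square algebra_simps)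
    qed
    finally show ?thesis .
  qed
  have "(\<Sum>i<2^n. \<Sum>j<2^n. (cmod (a i j + b i j + c i j + d i j))\<^sup>2) \<le>
    (\<Sum>i<2^n. \<Sum>j<2^n. 4 * ((cmod (a i j))\<^sup>2 + (cmod (b i j))\<^sup>2 + (cmod (c i j))\<^sup>2 + (cmod (d i j))\<^sup>2))"
    by (intro sum_mono *)
  also have "\<dots> = 4 * ((\<Sum>i<2^n. \<Sum>j<2^n. (cmod (a i j))\<^sup>2) + (\<Sum>i<2^n. \<Sum>j<2^n. (cmod (b i j))\<^sup>2)
      + (\<Sum>i<2^n. \<Sum>j<2^n. (cmod (c i j))\<^sup>2) + (\<Sum>i<2^n. \<Sum>j<2^n. (cmod (d i j))\<^sup>2))"
    by (simp add: sum.distrib sum_distrib_left[symmetric])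
  finally show ?thesis
    unfolding frob_def by (simp add: field_simps)
qed

text \<open>For Hermitian \<open>f\<close> this is \<open>tr(f\<^sup>4)\<^bsup>1/2\<^esup>\<close>, the square of the 4-norm. Squares are the convenient
  scale, since the induction for hypercontractivity compares them with squared 2-norms.\<close>

definition L4_sq :: "nat \<Rightarrow> entries \<Rightarrow> real" where
  "L4_sq n f = sqrt (frob n (mprod n f f))"

lemma L4_sq_nonneg [simp]: "0 \<le> L4_sq n f" unfolding L4_sq_def by simp

lemma sum_swap4:
  fixes T :: "_ \<Rightarrow> _ \<Rightarrow> _ \<Rightarrow> _ \<Rightarrow> 'a::comm_monoid_add"
  shows "(\<Sum>i\<in>A. \<Sum>j\<in>B. \<Sum>k\<in>C. \<Sum>l\<in>D. T i j k l) = (\<Sum>k\<in>C. \<Sum>l\<in>D. \<Sum>i\<in>A. \<Sum>j\<in>B. T i j k l)"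
proof -
  have "(\<Sum>i\<in>A. \<Sum>j\<in>B. \<Sum>k\<in>C. \<Sum>l\<in>D. T i j k l) = (\<Sum>i\<in>A. \<Sum>k\<in>C. \<Sum>l\<in>D. \<Sum>j\<in>B. T i j k l)"
    by (rule sum.cong[OF refl], subst sum.swap, rule sum.cong[OF refl], rule sum.swap)
  also have "\<dots> = (\<Sum>k\<in>C. \<Sum>l\<in>D. \<Sum>i\<in>A. \<Sum>j\<in>B. T i j k l)"
    by (subst sum.swap, rule sum.cong[OF refl], rule sum.swap)
  finally show ?thesis .
qed

text \<open>Cyclicity of the trace turns \<open>tr((xy)(xy)\<^sup>*)\<close> into \<open>tr(x\<^sup>2 y\<^sup>2)\<close>, to which Cauchy--Schwarz
  applies. This is all of noncommutative Hoelder that the fourth power requires.\<close>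

lemma frob_mprod_le:
  assumes "herm n x" "herm n y"
  shows "frob n (mprod n x y) \<le> L4_sq n x * L4_sq n y"
proof -
  let ?N = "{..<2^n} :: nat set"
  have hx: "cnj (x i j) = x j i" and hy: "cnj (y i j) = y j i" if "i \<in> ?N" "j \<in> ?N" for i j
    using assms that by (simp_all add: hermD)
  have "(\<Sum>i\<in>?N. \<Sum>j\<in>?N. mprod n x y i j * cnj (mprod n x y i j))
      = (\<Sum>i\<in>?N. \<Sum>j\<in>?N. \<Sum>k\<in>?N. \<Sum>l\<in>?N. x l i * x i k * (y k j * y j l))"
    unfolding mprod_def cnj_sum sum_product
  proof (intro sum.cong refl)
    fix i j k l assume "i \<in> ?N" "j \<in> ?N" "k \<in> ?N" "l \<in> ?N"
    then have "cnj (x i l) = x l i" "cnj (y l j) = y j l" by (blast intro: hx hy)+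
    then show "x i k * y k j * cnj (x i l * y l j) = x l i * x i k * (y k j * y j l)"
      by (simp only: complex_cnj_mult mult_ac)
  qed
  also have "\<dots> = (\<Sum>k\<in>?N. \<Sum>l\<in>?N. \<Sum>i\<in>?N. \<Sum>j\<in>?N. x l i * x i k * (y k j * y j l))"
    by (rule sum_swap4)
  also have "\<dots> = (\<Sum>k\<in>?N. \<Sum>l\<in>?N. mprod n x x l k * mprod n y y k l)"
    unfolding mprod_def sum_product by simp
  also have "\<dots> = (\<Sum>k\<in>?N. \<Sum>l\<in>?N. mprod n y y k l * cnj (mprod n x x k l))"
    unfolding mprod_def cnj_sum by (intro sum.cong refl) (simp add: hx mult.commute)
  finally have "complex_of_real (frob n (mprod n x y)) = ip n (mprod n y y) (mprod n x x)"
    unfolding frob_ip ip_def by simp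
  then have "frob n (mprod n x y) \<le> cmod (ip n (mprod n y y) (mprod n x x))"
    by (metis frob_nonneg norm_of_real abs_of_nonneg order_refl)
  also have "\<dots> \<le> L4_sq n y * L4_sq n x"
    unfolding L4_sq_def by (rule ip_Cauchy_Schwarz)
  finally show ?thesis by (simp add: mult.commute)
qed

lemma half_eq: "x = 2 * y \<Longrightarrow> x / 2 = y" for x y :: complex
  by simp

text \<open>From the multiplication table \<open>X Y = \<i> Z\<close> and its cyclic shifts: the squares of the four components
  land on \<open>1\<close>, the identity component contributes anticommutators to the others, and each pair of
  non-identity components contributes \<open>\<i>\<close> times its commutator to the third.\<close>

lemma pauli_mprod:
  defines "m \<equiv> \<lambda>n f. mprod (Suc n) f f"
  shows "pauli_I (m n f) i j = mprod n (pauli_I f) (pauli_I f) i j + mprod n (pauli_X f) (pauli_X f) i j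
      + mprod n (pauli_Y f) (pauli_Y f) i j + mprod n (pauli_Z f) (pauli_Z f) i j"
    and "pauli_X (m n f) i j = mprod n (pauli_I f) (pauli_X f) i j + mprod n (pauli_X f) (pauli_I f) i j
      + \<i> * mprod n (pauli_Y f) (pauli_Z f) i j + (- \<i>) * mprod n (pauli_Z f) (pauli_Y f) i j"
    and "pauli_Y (m n f) i j = mprod n (pauli_I f) (pauli_Y f) i j + mprod n (pauli_Y f) (pauli_I f) i j
      + \<i> * mprod n (pauli_Z f) (pauli_X f) i j + (- \<i>) * mprod n (pauli_X f) (pauli_Z f) i j"
    and "pauli_Z (m n f) i j = mprod n (pauli_I f) (pauli_Z f) i j + mprod n (pauli_Z f) (pauli_I f) i j
      + \<i> * mprod n (pauli_X f) (pauli_Y f) i j + (- \<i>) * mprod n (pauli_Y f) (pauli_X f) i j"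
  unfolding m_def pauli_I_def[of "mprod (Suc n) f f"] pauli_X_def[of "mprod (Suc n) f f"]
    pauli_Y_def[of "mprod (Suc n) f f"] pauli_Z_def[of "mprod (Suc n) f f"]
    mprod_def power_Suc sum_even_odd sum_distrib_left sum.distrib[symmetric]
    sum_subtractf[symmetric] sum_divide_distrib
  by (intro sum.cong refl half_eq; simp only: from_pauli[of f]; simp add: algebra_simps)+

section \<open>Noise and the energy at each Pauli weight\<close>

text \<open>The depolarizing semigroup: every non-identity Pauli factor is multiplied by \<open>t\<close>.\<close>

primrec noise :: "real \<Rightarrow> nat \<Rightarrow> entries \<Rightarrow> entries" where
  "noise t 0 f = f"
| "noise t (Suc n) f = glue (noise t n (pauli_I f)) (\<lambda>i j. of_real t * noise t n (pauli_X f) i j)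
     (\<lambda>i j. of_real t * noise t n (pauli_Y f) i j) (\<lambda>i j. of_real t * noise t n (pauli_Z f) i j)"

text \<open>The squared mass of \<open>f\<close> at Pauli weight \<open>k\<close>, weighted by \<open>\<phi> k\<close> and summed over \<open>k\<close>. Passing to a
  non-identity component uses up one unit of weight, hence the shift of \<open>\<phi>\<close>. Keeping \<open>\<phi>\<close> arbitrary
  lets one functional express the 2-norm, the variance, the damped energies, and inequalities between
  them.\<close>

primrec energy :: "nat \<Rightarrow> (nat \<Rightarrow> real) \<Rightarrow> entries \<Rightarrow> real" where
  "energy 0 \<phi> f = \<phi> 0 * (cmod (f 0 0))\<^sup>2"
| "energy (Suc n) \<phi> f = energy n \<phi> (pauli_I f) + energy n (\<lambda>k. \<phi> (Suc k)) (pauli_X f)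
     + energy n (\<lambda>k. \<phi> (Suc k)) (pauli_Y f) + energy n (\<lambda>k. \<phi> (Suc k)) (pauli_Z f)"

lemma energy_mono: "(\<And>k. \<phi> k \<le> \<psi> k) \<Longrightarrow> energy n \<phi> f \<le> energy n \<psi> f"
proof (induction n arbitrary: \<phi> \<psi> f)
  case 0 then show ?case by (simp add: mult_right_mono)
next
  case (Suc n) then show ?case by (auto intro!: add_mono Suc.IH)
qed

lemma energy_add: "energy n (\<lambda>k. \<phi> k + \<psi> k) f = energy n \<phi> f + energy n \<psi> f"
  by (induction n arbitrary: \<phi> \<psi> f) (simp_all add: algebra_simps)

lemma energy_scale: "energy n (\<lambda>k. c * \<phi> k) f = c * energy n \<phi> f"
  by (induction n arbitrary: \<phi> f) (simp_all add: algebra_simps)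

lemma energy_zero_weight: "energy n (\<lambda>_. 0) f = 0"
  using energy_scale[of n 0 "\<lambda>_. 0" f] by simp

lemma energy_nonneg: "(\<And>k. 0 \<le> \<phi> k) \<Longrightarrow> 0 \<le> energy n \<phi> f"
  using energy_mono[of "\<lambda>_. 0" \<phi> n f] by (simp add: energy_zero_weight)

lemma energy_zero_entries: "energy n \<phi> (\<lambda>_ _. 0) = 0"
proof -
  have "pauli_I (\<lambda>_ _. 0) = (\<lambda>_ _. 0)" "pauli_X (\<lambda>_ _. 0) = (\<lambda>_ _. 0)" "pauli_Y (\<lambda>_ _. 0) = (\<lambda>_ _. 0)"
    "pauli_Z (\<lambda>_ _. 0) = (\<lambda>_ _. 0)" by (simp_all add: pauli_defs fun_eq_iff)
  then show ?thesis by (induction n arbitrary: \<phi>) simp_all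
qed

lemma energy_one: "energy n (\<lambda>_. 1) f = frob n f"
  by (induction n arbitrary: f) (simp_all add: frob_Suc, simp add: frob_def)

text \<open>Only the string of identities has weight zero, and its coefficient is the trace.\<close>

lemma energy_trace: "energy n (\<lambda>k. if k = 0 then 1 else 0) f = (cmod (entries_tr n f))\<^sup>2"
proof (induction n arbitrary: f)
  case (Suc n)
  have "entries_tr (Suc n) f = entries_tr n (pauli_I f)"
    unfolding entries_tr_def power_Suc sum_even_odd pauli_I_def
    by (simp add: sum_divide_distrib sum.distrib add_divide_distrib)
  with Suc show ?case by (simp add: energy_zero_weight)
qed (simp add: entries_tr_def)

lemma ip_scale: "ip n (\<lambda>i j. c * f i j) g = c * ip n f g"
  unfolding ip_def by (simp add: sum_distrib_left mult.assoc)

text \<open>Noise is diagonal in the Pauli basis.\<close>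

lemma ip_noise: "ip n (noise t n f) f = of_real (energy n (\<lambda>k. t ^ k) f)"
proof (induction n arbitrary: f)
  case 0 then show ?case by (simp add: ip_def flip: complex_norm_square)
next
  case (Suc n)
  then show ?case by (simp add: ip_Suc ip_scale energy_scale algebra_simps)
qed

lemma herm_pauli:
  assumes "herm (Suc n) f"
  shows "herm n (pauli_I f)" "herm n (pauli_X f)" "herm n (pauli_Y f)" "herm n (pauli_Z f)"
proof -
  have lt: "2 * i < 2 ^ Suc n" "Suc (2 * i) < 2 ^ Suc n" if "i < 2 ^ n" for i :: nat
    using that by auto
  have "f s r = cnj (f r s)" if "r < 2 ^ Suc n" "s < 2 ^ Suc n" for r s
    using assms that unfolding herm_def by blast
  then have h: "f (2*j) (2*i) = cnj (f (2*i) (2*j))"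
      "f (2*j) (Suc (2*i)) = cnj (f (Suc (2*i)) (2*j))"
      "f (Suc (2*j)) (2*i) = cnj (f (2*i) (Suc (2*j)))"
      "f (Suc (2*j)) (Suc (2*i)) = cnj (f (Suc (2*i)) (Suc (2*j)))"
    if "i < 2 ^ n" "j < 2 ^ n" for i j
    using lt that by blast+
  show "herm n (pauli_I f)" "herm n (pauli_X f)" "herm n (pauli_Y f)" "herm n (pauli_Z f)"
    unfolding herm_def
  proof (safe)
    fix i j :: nat assume ij: "i < 2 ^ n" "j < 2 ^ n"
    note h = h[OF ij]
    show "pauli_I f j i = cnj (pauli_I f i j)" "pauli_X f j i = cnj (pauli_X f i j)"
      "pauli_Y f j i = cnj (pauli_Y f i j)" "pauli_Z f j i = cnj (pauli_Z f i j)"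
      unfolding pauli_defs by (simp_all only: h) (simp_all add: algebra_simps)
  qed
qed

lemma herm_glue:
  assumes "herm n a" "herm n x" "herm n y" "herm n z"
  shows "herm (Suc n) (glue a x y z)"
  unfolding herm_def
proof (intro allI impI)
  fix i j :: nat assume "i < 2 ^ Suc n" "j < 2 ^ Suc n"
  then have "i div 2 < 2 ^ n" "j div 2 < 2 ^ n" by auto
  with assms have "a (j div 2) (i div 2) = cnj (a (i div 2) (j div 2))"
    "x (j div 2) (i div 2) = cnj (x (i div 2) (j div 2))"
    "y (j div 2) (i div 2) = cnj (y (i div 2) (j div 2))"
    "z (j div 2) (i div 2) = cnj (z (i div 2) (j div 2))"
    unfolding herm_def by blast+
  then show "glue a x y z j i = cnj (glue a x y z i j)"
    unfolding glue_def Let_def by auto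
qed

lemma herm_scale: "herm n f \<Longrightarrow> herm n (\<lambda>i j. of_real t * f i j)"
  by (rule hermI) (simp add: hermD)

lemma herm_noise: "herm n f \<Longrightarrow> herm n (noise t n f)"
proof (induction n arbitrary: f)
  case (Suc n)
  show ?case unfolding noise.simps
    by (intro herm_glue herm_scale Suc.IH herm_pauli[OF Suc.prems])
qed simp

lemma mprod_scale:
  "mprod n (\<lambda>i j. c * f i j) g i j = c * mprod n f g i j"
  "mprod n f (\<lambda>i j. c * g i j) i j = c * mprod n f g i j"
  unfolding mprod_def by (simp_all add: sum_distrib_left mult_ac)

section \<open>Hypercontractivity\<close>

text \<open>With \<open>s = x + y + z\<close>, the left side is at most \<open>a\<^sup>2 + 10 t\<^sup>2 a s + 9 t\<^sup>4 s\<^sup>2\<close>, so the requirement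
  from the mixed term is \<open>10 t\<^sup>2 \<le> 2 t\<close>. This is where \<open>1/5\<close> comes from.\<close>

lemma two_point_inequality:
  fixes t a x y z :: real
  assumes t: "0 \<le> t" "t \<le> 1/5" and nn: "0 \<le> a" "0 \<le> x" "0 \<le> y" "0 \<le> z"
  shows "(a + t\<^sup>2 * (x + y + z))\<^sup>2 + 8 * (t\<^sup>2 * a * x + t^4 * y * z)
      + 8 * (t\<^sup>2 * a * y + t^4 * z * x) + 8 * (t\<^sup>2 * a * z + t^4 * x * y)
    \<le> (a + t * (x + y + z))\<^sup>2"
proof -
  let ?s = "x + y + z"
  have t2: "5 * t\<^sup>2 \<le> t"
    using mult_left_mono[OF t(2) t(1)] by (simp add: power2_eq_square)
  have "25 * t^4 \<le> t\<^sup>2"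
    using power_mono[OF t2, of 2] t by (simp add: power_mult_distrib)
  moreover have "0 \<le> t^4" by simp
  ultimately have t4: "9 * t^4 \<le> t\<^sup>2" by linarith
  have sq: "x * y + y * z + z * x \<le> ?s\<^sup>2"
    using nn by (simp add: power2_eq_square algebra_simps)
  have "(a + t\<^sup>2 * ?s)\<^sup>2 + 8 * (t\<^sup>2 * a * x + t^4 * y * z)
      + 8 * (t\<^sup>2 * a * y + t^4 * z * x) + 8 * (t\<^sup>2 * a * z + t^4 * x * y)
    = a\<^sup>2 + 10 * t\<^sup>2 * (a * ?s) + t^4 * ?s\<^sup>2 + 8 * t^4 * (x * y + y * z + z * x)"
    by (simp add: power2_eq_square power4_eq_xxxx algebra_simps)
  also have "\<dots> \<le> a\<^sup>2 + 10 * t\<^sup>2 * (a * ?s) + t^4 * ?s\<^sup>2 + 8 * t^4 * ?s\<^sup>2"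
    using sq by (intro add_left_mono mult_left_mono) auto
  also have "\<dots> = a\<^sup>2 + 2 * (5 * t\<^sup>2) * (a * ?s) + (9 * t^4) * ?s\<^sup>2"
    by (simp add: algebra_simps)
  also have "\<dots> \<le> a\<^sup>2 + 2 * t * (a * ?s) + t\<^sup>2 * ?s\<^sup>2"
    using t2 t4 nn by (intro add_mono mult_right_mono mult_left_mono) auto
  also have "\<dots> = (a + t * ?s)\<^sup>2" by (simp add: power2_eq_square algebra_simps)
  finally show ?thesis .
qed

text \<open>The induction step of hypercontractivity. The identity component of the square is estimated by the
  triangle inequality, which keeps the coefficient of \<open>(L4_sq n a)\<^sup>2\<close> equal to one; the other
  components carry a factor \<open>t\<^sup>2\<close>, so there the lossy bound \<open>frob_add4_le\<close> suffices.\<close>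

lemma L4_sq_glue_le:
  assumes h: "herm n a" "herm n x" "herm n y" "herm n z" and t: "0 \<le> t" "t \<le> 1/5"
  defines "s \<equiv> \<lambda>f i j. complex_of_real t * f i j"
  shows "L4_sq (Suc n) (glue a (s x) (s y) (s z)) \<le> L4_sq n a + t * (L4_sq n x + L4_sq n y + L4_sq n z)"
proof -
  let ?f = "glue a (s x) (s y) (s z)"
  have fr: "frob n (mprod n (s u) (s v)) = t^4 * frob n (mprod n u v)" for u v
  proof -
    have "mprod n (s u) (s v) = (\<lambda>i j. of_real (t\<^sup>2) * mprod n u v i j)"
      by (simp add: s_def mprod_scale fun_eq_iff power2_eq_square)
    then show ?thesis
      by (simp only: frob_scale norm_of_real) (simp flip: power_mult)
  qed
  have fr1: "frob n (mprod n a (s v)) = t\<^sup>2 * frob n (mprod n a v)"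
      "frob n (mprod n (s v) a) = t\<^sup>2 * frob n (mprod n v a)" for v
    using frob_scale[of n "of_real t" "mprod n a v"] frob_scale[of n "of_real t" "mprod n v a"]
    by (simp_all add: s_def mprod_scale[abs_def])
  \<comment> \<open>identity component: coefficient one for \<open>(L4_sq n a)\<^sup>2\<close>\<close>
  have I: "frob n (pauli_I (mprod (Suc n) ?f ?f)) \<le> (L4_sq n a + t\<^sup>2 * (L4_sq n x + L4_sq n y + L4_sq n z))\<^sup>2"
  proof -
    have sq: "sqrt (frob n (mprod n (s u) (s u))) = t\<^sup>2 * L4_sq n u" for u
    proof -
      have "sqrt (t^4) = t\<^sup>2" using real_sqrt_abs[of "t\<^sup>2"] by (simp flip: power_mult)
      then show ?thesis by (simp add: fr L4_sq_def real_sqrt_mult)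
    qed
    have "sqrt (frob n (pauli_I (mprod (Suc n) ?f ?f))) \<le> sqrt (frob n (mprod n a a))
      + sqrt (frob n (mprod n (s x) (s x))) + sqrt (frob n (mprod n (s y) (s y)))
      + sqrt (frob n (mprod n (s z) (s z)))"
      unfolding pauli_mprod(1)[abs_def] pauli_glue
      by (intro order_trans[OF sqrt_frob_triangle] add_right_mono order_refl)
    also have "\<dots> = L4_sq n a + t\<^sup>2 * (L4_sq n x + L4_sq n y + L4_sq n z)"
      unfolding sq by (simp add: L4_sq_def algebra_simps)
    finally have "(sqrt (frob n (pauli_I (mprod (Suc n) ?f ?f))))\<^sup>2 \<le> (L4_sq n a + t\<^sup>2 * (L4_sq n x + L4_sq n y + L4_sq n z))\<^sup>2"
      by (rule power_mono) simp
    then show ?thesis by simp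
  qed
  have J: "frob n (\<lambda>i j. mprod n a (s u) i j + mprod n (s u) a i j
        + \<i> * mprod n (s v) (s w) i j + (- \<i>) * mprod n (s w) (s v) i j)
      \<le> 8 * (t\<^sup>2 * L4_sq n a * L4_sq n u + t^4 * L4_sq n v * L4_sq n w)"
    if "herm n u" "herm n v" "herm n w" for u v w
  proof -
    have "frob n (\<lambda>i j. mprod n a (s u) i j + mprod n (s u) a i j
        + \<i> * mprod n (s v) (s w) i j + (- \<i>) * mprod n (s w) (s v) i j)
      \<le> 4 * (t\<^sup>2 * frob n (mprod n a u) + t\<^sup>2 * frob n (mprod n u a)
        + t^4 * frob n (mprod n v w) + t^4 * frob n (mprod n w v))"
      using frob_add4_le[of n "mprod n a (s u)" "mprod n (s u) a"
        "\<lambda>i j. \<i> * mprod n (s v) (s w) i j" "\<lambda>i j. (- \<i>) * mprod n (s w) (s v) i j"]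
      by (simp only: frob_scale fr fr1) simp
    also have "\<dots> \<le> 4 * (t\<^sup>2 * (L4_sq n a * L4_sq n u) + t\<^sup>2 * (L4_sq n u * L4_sq n a)
        + t^4 * (L4_sq n v * L4_sq n w) + t^4 * (L4_sq n w * L4_sq n v))"
      using that h by (intro mult_left_mono add_mono frob_mprod_le) auto
    finally show ?thesis by (simp add: algebra_simps)
  qed
  have "(L4_sq (Suc n) ?f)\<^sup>2 = frob n (pauli_I (mprod (Suc n) ?f ?f)) + frob n (pauli_X (mprod (Suc n) ?f ?f))
      + frob n (pauli_Y (mprod (Suc n) ?f ?f)) + frob n (pauli_Z (mprod (Suc n) ?f ?f))"
    unfolding L4_sq_def by (simp add: frob_Suc)
  also have "\<dots> \<le> (L4_sq n a + t\<^sup>2 * (L4_sq n x + L4_sq n y + L4_sq n z))\<^sup>2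
      + 8 * (t\<^sup>2 * L4_sq n a * L4_sq n x + t^4 * L4_sq n y * L4_sq n z)
      + 8 * (t\<^sup>2 * L4_sq n a * L4_sq n y + t^4 * L4_sq n z * L4_sq n x)
      + 8 * (t\<^sup>2 * L4_sq n a * L4_sq n z + t^4 * L4_sq n x * L4_sq n y)"
    unfolding pauli_mprod(2-4)[abs_def] pauli_glue by (intro add_mono I J h)
  also have "\<dots> \<le> (L4_sq n a + t * (L4_sq n x + L4_sq n y + L4_sq n z))\<^sup>2"
    by (intro two_point_inequality t L4_sq_nonneg)
  finally show ?thesis by (rule power2_le_imp_le) (use t in auto)
qed

text \<open>In terms of norms: noise with parameter \<open>t = r\<^sup>2\<close> maps \<open>f\<close> to a matrix whose 4-norm is at most the
  2-norm of the noise with parameter \<open>r\<close> applied to \<open>f\<close>.\<close>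

theorem hypercontractivity:
  assumes "herm n f" "0 \<le> t" "t \<le> 1/5"
  shows "L4_sq n (noise t n f) \<le> energy n (\<lambda>k. t ^ k) f"
  using assms(1)
proof (induction n arbitrary: f)
  case 0
  then show ?case by (simp add: L4_sq_def frob_def mprod_def norm_mult power2_eq_square)
next
  case (Suc n)
  note h = herm_pauli[OF Suc.prems]
  have "L4_sq (Suc n) (noise t (Suc n) f) \<le> L4_sq n (noise t n (pauli_I f))
      + t * (L4_sq n (noise t n (pauli_X f)) + L4_sq n (noise t n (pauli_Y f)) + L4_sq n (noise t n (pauli_Z f)))"
    unfolding noise.simps by (intro L4_sq_glue_le herm_noise h assms)
  also have "\<dots> \<le> energy n (\<lambda>k. t ^ k) (pauli_I f) + t * (energy n (\<lambda>k. t ^ k) (pauli_X f)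
      + energy n (\<lambda>k. t ^ k) (pauli_Y f) + energy n (\<lambda>k. t ^ k) (pauli_Z f))"
    using assms by (intro add_mono mult_left_mono Suc.IH h)
  also have "\<dots> = energy (Suc n) (\<lambda>k. t ^ k) f"
    by (simp add: energy_scale algebra_simps)
  finally show ?case .
qed

section \<open>Partial derivatives in Pauli coordinates\<close>

text \<open>Subtracting the average over the tensor factor of bit \<open>m\<close>: entries whose row and column differ in
  that bit are off-diagonal in that factor and stay, while a diagonal one is replaced by half its
  difference from the entry with that bit flipped in both indices.\<close>

definition bit_deriv :: "nat \<Rightarrow> entries \<Rightarrow> entries" where
  "bit_deriv m f r s = (if bit r m = bit s m then (f r s - f (flip_bit m r) (flip_bit m s)) / 2 else f r s)"

lemma pauli_bit_deriv_0:
  "pauli_I (bit_deriv 0 f) = (\<lambda>_ _. 0)" "pauli_X (bit_deriv 0 f) = pauli_X f" "pauli_Y (bit_deriv 0 f) = pauli_Y f" "pauli_Z (bit_deriv 0 f) = pauli_Z f"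
  by (simp_all add: fun_eq_iff pauli_defs bit_deriv_def bit_0 flip_bit_0 field_simps)

text \<open>Splitting off the last tensor factor commutes with derivatives in the other factors.\<close>

lemma pauli_bit_deriv_Suc:
  "pauli_I (bit_deriv (Suc m) f) = bit_deriv m (pauli_I f)" "pauli_X (bit_deriv (Suc m) f) = bit_deriv m (pauli_X f)"
  "pauli_Y (bit_deriv (Suc m) f) = bit_deriv m (pauli_Y f)" "pauli_Z (bit_deriv (Suc m) f) = bit_deriv m (pauli_Z f)"
proof -
  have "flip_bit (Suc m) (2 * i) = 2 * flip_bit m i"
    "flip_bit (Suc m) (Suc (2 * i)) = Suc (2 * flip_bit m i)" for i :: nat
    by (simp_all add: flip_bit_Suc)
  then show "pauli_I (bit_deriv (Suc m) f) = bit_deriv m (pauli_I f)" "pauli_X (bit_deriv (Suc m) f) = bit_deriv m (pauli_X f)"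
    "pauli_Y (bit_deriv (Suc m) f) = bit_deriv m (pauli_Y f)" "pauli_Z (bit_deriv (Suc m) f) = bit_deriv m (pauli_Z f)"
    by (simp_all add: fun_eq_iff pauli_defs bit_deriv_def bit_Suc field_simps)
qed

text \<open>A string of weight \<open>k\<close> survives in exactly \<open>k\<close> of the derivatives.\<close>

lemma sum_energy_bit_deriv:
  "(\<Sum>m<n. energy n \<phi> (bit_deriv m f)) = energy n (\<lambda>k. real k * \<phi> k) f"
proof (induction n arbitrary: \<phi> f)
  case 0 then show ?case by simp
next
  case (Suc n)
  have S: "energy n (\<lambda>k. real (Suc k) * \<phi> (Suc k)) g =
     energy n (\<lambda>k. \<phi> (Suc k)) g + energy n (\<lambda>k. real k * \<phi> (Suc k)) g" for g
    by (simp add: energy_add[symmetric] algebra_simps)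
  show ?case
    unfolding sum.lessThan_Suc_shift energy.simps pauli_bit_deriv_0 pauli_bit_deriv_Suc sum.distrib Suc.IH S
      energy_zero_entries by simp
qed

section \<open>The spectral theorem for Hermitian matrices\<close>

lemma adjoint_index [simp]:
  "i < dim_col A \<Longrightarrow> j < dim_row A \<Longrightarrow> mat_adjoint A $$ (i, j) = cnj (A $$ (j, i))"
  for A :: "complex mat"
  unfolding mat_adjoint_def mat_of_rows_def by simp

lemma adjoint_dim [simp]: "dim_row (mat_adjoint A) = dim_col A" "dim_col (mat_adjoint A) = dim_row A"
  unfolding mat_adjoint_def by auto

lemma adjoint_adjoint: "mat_adjoint (mat_adjoint A) = A" for A :: "complex mat"
  by (intro eq_matI) auto

lemma adjoint_mult:
  fixes A B :: "complex mat"
  assumes "A \<in> carrier_mat m n" "B \<in> carrier_mat n k"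
  shows "mat_adjoint (A * B) = mat_adjoint B * mat_adjoint A"
proof (rule eq_matI)
  fix i j assume "i < dim_row (mat_adjoint B * mat_adjoint A)" "j < dim_col (mat_adjoint B * mat_adjoint A)"
  then have ij: "i < k" "j < m" using assms by auto
  show "mat_adjoint (A * B) $$ (i, j) = (mat_adjoint B * mat_adjoint A) $$ (i, j)"
    using ij assms by (simp add: scalar_prod_def mult.commute)
qed (use assms in auto)

text \<open>Gram--Schmidt orthogonalization without normalization (\<open>gram_schmidt\<close>) leaves vectors of arbitrary
  length; rescaling them gives the columns of a unitary matrix.\<close>

lemma unitary_of_corthogonal:
  fixes ws :: "complex vec list"
  assumes ws: "set ws \<subseteq> carrier_vec n" "corthogonal ws" "length ws = n"
  obtains U c where "U \<in> carrier_mat n n" "mat_adjoint U * U = 1\<^sub>m n" "U * mat_adjoint U = 1\<^sub>m n"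
    "\<And>j. j < n \<Longrightarrow> col U j = c j \<cdot>\<^sub>v ws ! j"
proof -
  define s where "s j = Re ((ws ! j) \<bullet>c (ws ! j))" for j
  define c where "c j = complex_of_real (1 / sqrt (s j))" for j
  define U where "U = mat n n (\<lambda>(i, j). c j * (ws ! j) $ i)"
  have cv: "ws ! j \<in> carrier_vec n" if "j < n" for j using ws that by auto
  have s: "complex_of_real (s j) = (ws ! j) \<bullet>c (ws ! j)" "0 < s j" if j: "j < n" for j
  proof -
    have "(ws ! j) \<bullet>c (ws ! j) \<noteq> 0" using corthogonalD[OF ws(2), of j j] j ws by auto
    moreover have "(ws ! j) \<bullet>c (ws ! j) \<ge> 0" by (rule conjugate_square_ge_0_vec)
    ultimately show "complex_of_real (s j) = (ws ! j) \<bullet>c (ws ! j)" "0 < s j"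
      unfolding s_def by (auto simp: complex_eq_iff less_eq_complex_def)
  qed
  have U: "U \<in> carrier_mat n n" unfolding U_def by simp
  have UU: "mat_adjoint U * U = 1\<^sub>m n"
  proof (rule eq_matI)
    fix i j assume "i < dim_row (1\<^sub>m n :: complex mat)" "j < dim_col (1\<^sub>m n :: complex mat)"
    then have ij: "i < n" "j < n" by auto
    have "(mat_adjoint U * U) $$ (i, j) = (\<Sum>k<n. cnj (c i * (ws ! i) $ k) * (c j * (ws ! j) $ k))"
      using ij U by (simp add: scalar_prod_def U_def atLeast0LessThan)
    also have "\<dots> = c i * c j * ((ws ! j) \<bullet>c (ws ! i))"
      using cv[OF ij(1)] cv[OF ij(2)]
      by (simp add: scalar_prod_def atLeast0LessThan sum_distrib_left c_def mult_ac)
    also have "\<dots> = 1\<^sub>m n $$ (i, j)"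
    proof (cases "i = j")
      case True
      have "c i * c i * ((ws ! i) \<bullet>c (ws ! i)) = 1"
        unfolding s(1)[OF ij(1), symmetric] c_def using s(2)[OF ij(1)] by (simp flip: of_real_mult)
      then show ?thesis using True ij by simp
    next
      case False
      then show ?thesis using ij corthogonalD[OF ws(2), of j i] ws by simp
    qed
    finally show "(mat_adjoint U * U) $$ (i, j) = 1\<^sub>m n $$ (i, j)" .
  qed (use U in auto)
  have "U * mat_adjoint U = 1\<^sub>m n"
    using mat_mult_left_right_inverse[OF adjoint_carrier[OF U] U UU] .
  moreover have "col U j = c j \<cdot>\<^sub>v ws ! j" if "j < n" for j
    using cv[OF that] that by (intro eq_vecI) (auto simp: U_def)
  ultimately show ?thesis using that U UU by blast
qed

lemma exists_eigenvector:
  fixes A :: "complex mat"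
  assumes A: "A \<in> carrier_mat n n" and n: "0 < n"
  obtains e v where "v \<in> carrier_vec n" "v \<noteq> 0\<^sub>v n" "A *\<^sub>v v = e \<cdot>\<^sub>v v"
proof -
  from spectrum_non_empty[OF A] n obtain e where "eigenvalue A e" unfolding spectrum_def by auto
  then show ?thesis using that A unfolding eigenvalue_def eigenvector_def by auto
qed

lemma unitary_with_eigenvector_column:
  fixes A :: "complex mat"
  assumes A: "A \<in> carrier_mat (Suc n) (Suc n)"
  obtains U e where "U \<in> carrier_mat (Suc n) (Suc n)" "mat_adjoint U * U = 1\<^sub>m (Suc n)"
    "U * mat_adjoint U = 1\<^sub>m (Suc n)" "A *\<^sub>v col U 0 = e \<cdot>\<^sub>v col U 0"
proof -
  obtain e v where v: "v \<in> carrier_vec (Suc n)" "v \<noteq> 0\<^sub>v (Suc n)" "A *\<^sub>v v = e \<cdot>\<^sub>v v"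
    using exists_eigenvector[OF A zero_less_Suc] by blast
  define b where "b = basis_completion v"
  define ws where "ws = gram_schmidt (Suc n) b"
  interpret cof_vec_space "Suc n" "TYPE(complex)" .
  from basis_completion[OF v(1,2), folded b_def]
  have b: "distinct b" "\<not> lin_dep (set b)" "set b \<subseteq> carrier_vec (Suc n)" "hd b = v"
    "length b = Suc n" by auto
  then obtain vs where bv: "b = v # vs" by (cases b) auto
  from gram_schmidt_result[OF b(3,1,2) refl, folded ws_def] b(5)
  have ws: "set ws \<subseteq> carrier_vec (Suc n)" "corthogonal ws" "length ws = Suc n" by auto
  have hd: "hd ws = v" using gram_schmidt_hd[OF v(1), of vs] unfolding ws_def bv .
  then have ws0: "ws ! 0 = v" using ws(3) by (cases ws) auto
  obtain U c where U: "U \<in> carrier_mat (Suc n) (Suc n)" "mat_adjoint U * U = 1\<^sub>m (Suc n)"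
    "U * mat_adjoint U = 1\<^sub>m (Suc n)" "\<And>j. j < Suc n \<Longrightarrow> col U j = c j \<cdot>\<^sub>v ws ! j"
    using unitary_of_corthogonal[OF ws] by metis
  have "A *\<^sub>v col U 0 = c 0 \<cdot>\<^sub>v (e \<cdot>\<^sub>v v)"
    using U(4)[of 0] v A by (simp add: ws0 mult_mat_vec)
  also have "\<dots> = e \<cdot>\<^sub>v col U 0"
    using U(4)[of 0] by (simp add: ws0 smult_smult_assoc mult.commute)
  finally show ?thesis using that U by blast
qed

text \<open>Conjugating by a unitary whose first column is an eigenvector makes the first column, and by
  symmetry the first row, vanish off the diagonal; the remaining block is Hermitian of smaller
  size.\<close>

theorem hermitian_spectral:
  assumes "A \<in> carrier_mat n n" "mat_adjoint A = A"
  shows "\<exists>U d. unitarily_diagonalizes U d A"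
  using assms
proof (induction n arbitrary: A)
  case 0
  then have "unitarily_diagonalizes (1\<^sub>m 0) (\<lambda>_. 0) A"
    unfolding unitarily_diagonalizes_def by (auto intro!: eq_matI)
  then show ?case by blast
next
  case (Suc n)
  note A = Suc.prems(1)
  obtain U e where U: "U \<in> carrier_mat (Suc n) (Suc n)" "mat_adjoint U * U = 1\<^sub>m (Suc n)"
    "U * mat_adjoint U = 1\<^sub>m (Suc n)" "A *\<^sub>v col U 0 = e \<cdot>\<^sub>v col U 0"
    using unitary_with_eigenvector_column[OF A] by metis
  define US where "US = mat_adjoint U"
  have US: "US \<in> carrier_mat (Suc n) (Suc n)" unfolding US_def by (rule adjoint_carrier[OF U(1)])
  define B where "B = US * A * U"
  have B: "B \<in> carrier_mat (Suc n) (Suc n)" unfolding B_def using U US A by auto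
  have Bh: "mat_adjoint B = B"
    unfolding B_def using U A US Suc.prems(2)
    by (simp add: adjoint_mult[of _ "Suc n" "Suc n" _ "Suc n"] US_def adjoint_adjoint
      assoc_mult_mat[of _ "Suc n" "Suc n" _ "Suc n" _ "Suc n"])
  have Bsym: "B $$ (i, j) = cnj (B $$ (j, i))" if "i < Suc n" "j < Suc n" for i j
    using that B adjoint_index[of i B j] unfolding Bh by auto
  have col0: "B $$ (i, 0) = (if i = 0 then e else 0)" if "i < Suc n" for i
  proof -
    have "B $$ (i, 0) = row US i \<bullet> (A *\<^sub>v col U 0)"
    proof -
      have "B = US * (A * U)" unfolding B_def by (rule assoc_mult_mat[OF US A U(1)])
      then have "B $$ (i, 0) = row US i \<bullet> col (A * U) 0"
        using that carrier_matD[OF US] carrier_matD[OF U(1)] by simp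
      then show ?thesis by (simp only: col_mult2[OF A U(1) zero_less_Suc])
    qed
    also have "\<dots> = e * (row US i \<bullet> col U 0)"
      unfolding U(4) using US U that col_dim[of U 0]
      by (intro scalar_prod_smult_distrib[of _ "Suc n"]) auto
    also have "row US i \<bullet> col U 0 = (US * U) $$ (i, 0)" using that US U by simp
    finally show ?thesis using that U(2) by (simp add: US_def)
  qed
  have row0: "B $$ (0, i) = (if i = 0 then e else 0)" if "i < Suc n" for i
    using Bsym[of 0 i] col0[of i] col0[of 0] Bsym[of 0 0] that by auto
  have e: "e = of_real (Re e)"
    using Bsym[of 0 0] col0[of 0] by (auto simp: complex_eq_iff)
  define C where "C = mat n n (\<lambda>(i, j). B $$ (Suc i, Suc j))"
  have C: "C \<in> carrier_mat n n" unfolding C_def by simp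
  have "mat_adjoint C = C"
    by (intro eq_matI) (auto simp: C_def intro!: Bsym[symmetric])
  from Suc.IH[OF C this] obtain V d where V: "unitarily_diagonalizes V d C" by blast
  have Vc: "V \<in> carrier_mat n n" using V C unfolding unitarily_diagonalizes_def by auto
  \<comment> \<open>the unitary matrix \<open>1 \<oplus> V\<close>\<close>
  define W where "W = mat (Suc n) (Suc n) (\<lambda>(i, j). if i = 0 \<and> j = 0 then 1
      else if i = 0 \<or> j = 0 then 0 else V $$ (i - 1, j - 1))"
  define d' where "d' i = (if i = 0 then Re e else d (i - 1))" for i
  have W: "W \<in> carrier_mat (Suc n) (Suc n)" unfolding W_def by simp
  have sum_conv: "(\<Sum>k<Suc n. W $$ (i, k) * of_real (g k) * cnj (W $$ (j, k))) =
      (if i = 0 \<and> j = 0 then of_real (g 0) else if i = 0 \<or> j = 0 then 0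
       else (\<Sum>k<n. V $$ (i - 1, k) * of_real (g (Suc k)) * cnj (V $$ (j - 1, k))))"
    if "i < Suc n" "j < Suc n" for i j and g :: "nat \<Rightarrow> real"
    unfolding sum.lessThan_Suc_shift using that by (auto simp: W_def)
  have diag_entry: "(X * mat_diag m (\<lambda>i. of_real (g i)) * mat_adjoint X) $$ (i, j) =
      (\<Sum>k<m. X $$ (i, k) * of_real (g k) * cnj (X $$ (j, k)))"
    if "X \<in> carrier_mat m m" "i < m" "j < m" for X m g i j
    using that by (simp add: mat_diag_mult_right[of X m m] scalar_prod_def atLeast0LessThan)
  have WW: "W * mat_adjoint W = 1\<^sub>m (Suc n)"
  proof (rule eq_matI)
    fix i j assume "i < dim_row (1\<^sub>m (Suc n) :: complex mat)" "j < dim_col (1\<^sub>m (Suc n) :: complex mat)"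
    then have ij: "i < Suc n" "j < Suc n" by auto
    have VV: "V * mat_adjoint V = 1\<^sub>m n" using V C unfolding unitarily_diagonalizes_def by auto
    have "(W * mat_adjoint W) $$ (i, j) = (\<Sum>k<Suc n. W $$ (i, k) * of_real 1 * cnj (W $$ (j, k)))"
      using ij W by (simp add: scalar_prod_def atLeast0LessThan del: sum.lessThan_Suc)
    also have "\<dots> = 1\<^sub>m (Suc n) $$ (i, j)"
    proof -
      have "(\<Sum>k<n. V $$ (i - 1, k) * cnj (V $$ (j - 1, k))) = 1\<^sub>m n $$ (i - 1, j - 1)"
        if "i \<noteq> 0" "j \<noteq> 0"
        unfolding VV[symmetric] using Vc that ij by (simp add: scalar_prod_def atLeast0LessThan)
      then show ?thesis using sum_conv[OF ij, of "\<lambda>_. 1"] ij by (auto simp del: sum.lessThan_Suc)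
    qed
    finally show "(W * mat_adjoint W) $$ (i, j) = 1\<^sub>m (Suc n) $$ (i, j)" .
  qed (use W in auto)
  have WW': "mat_adjoint W * W = 1\<^sub>m (Suc n)"
    using mat_mult_left_right_inverse[OF W adjoint_carrier[OF W] WW] .
  have BW: "B = W * mat_diag (Suc n) (\<lambda>i. of_real (d' i)) * mat_adjoint W" (is "B = ?R")
  proof (rule eq_matI)
    fix i j assume "i < dim_row ?R" "j < dim_col ?R"
    then have ij: "i < Suc n" "j < Suc n" using W by auto
    have CV: "C = V * mat_diag n (\<lambda>i. of_real (d i)) * mat_adjoint V"
      using V C unfolding unitarily_diagonalizes_def by auto
    have "B $$ (i, j) = (\<Sum>k<n. V $$ (i - 1, k) * of_real (d' (Suc k)) * cnj (V $$ (j - 1, k)))"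
      if "i \<noteq> 0" "j \<noteq> 0"
    proof -
      have "B $$ (i, j) = C $$ (i - 1, j - 1)" using that ij by (simp add: C_def)
      also have "\<dots> = (\<Sum>k<n. V $$ (i - 1, k) * of_real (d k) * cnj (V $$ (j - 1, k)))"
        by (subst CV, rule diag_entry[OF Vc]) (use that ij in auto)
      finally show ?thesis by (simp add: d'_def)
    qed
    then have "B $$ (i, j) = (\<Sum>k<Suc n. W $$ (i, k) * of_real (d' k) * cnj (W $$ (j, k)))"
      unfolding sum_conv[OF ij] using col0[of i] row0[of j] ij e by (auto simp: d'_def)
    then show "B $$ (i, j) = ?R $$ (i, j)" using diag_entry[OF W ij] by simp
  qed (use B W in auto)
  note asc = assoc_mult_mat[of _ "Suc n" "Suc n" _ "Suc n" _ "Suc n"]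
  have c4: "X * Y \<in> carrier_mat (Suc n) (Suc n)" if "X \<in> carrier_mat (Suc n) (Suc n)"
    "Y \<in> carrier_mat (Suc n) (Suc n)" for X Y :: "complex mat" using that by auto
  have can: "X * (Y * Z) = Z" if "X * Y = 1\<^sub>m (Suc n)" "X \<in> carrier_mat (Suc n) (Suc n)"
    "Y \<in> carrier_mat (Suc n) (Suc n)" "Z \<in> carrier_mat (Suc n) (Suc n)" for X Y Z :: "complex mat"
    using asc[of X Y Z] that by (metis left_mult_one_mat)
  define D where "D = mat_diag (Suc n) (\<lambda>i. complex_of_real (d' i))"
  have D: "D \<in> carrier_mat (Suc n) (Suc n)" unfolding D_def by simp
  define WS where "WS = mat_adjoint W"
  have WS: "WS \<in> carrier_mat (Suc n) (Suc n)" unfolding WS_def by (rule adjoint_carrier[OF W])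
  have UWa: "mat_adjoint (U * W) = WS * US"
    unfolding WS_def US_def by (rule adjoint_mult[OF U(1) W])
  have "A = U * B * US"
  proof -
    have "U * B * US = U * (US * (A * (U * US)))" unfolding B_def using A U US by (simp add: asc c4)
    also have "\<dots> = A * (U * US)" using U(3) A U US by (intro can) (auto simp: US_def)
    also have "\<dots> = A" using U(3) A by (simp add: US_def)
    finally show ?thesis by simp
  qed
  also have "\<dots> = (U * W) * D * (WS * US)"
    unfolding BW D_def[symmetric] WS_def[symmetric] using U US W WS D by (simp add: asc c4)
  finally have AE: "A = (U * W) * D * mat_adjoint (U * W)" unfolding UWa .
  have "(U * W) * (WS * US) = 1\<^sub>m (Suc n)"
  proof -
    have "(U * W) * (WS * US) = U * (W * (WS * US))" using U W WS US by (simp add: asc c4)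
    also have "W * (WS * US) = US" using WW W WS US by (intro can) (auto simp: WS_def)
    finally show ?thesis using U(3) by (simp add: US_def)
  qed
  moreover have "(WS * US) * (U * W) = 1\<^sub>m (Suc n)"
  proof -
    have "(WS * US) * (U * W) = WS * (US * (U * W))" using U W WS US by (simp add: asc c4)
    also have "US * (U * W) = W" using U W US by (intro can) (auto simp: US_def)
    finally show ?thesis using WW' by (simp add: WS_def)
  qed
  ultimately have "unitarily_diagonalizes (U * W) d' A"
    unfolding unitarily_diagonalizes_def using A U W AE UWa D_def by auto
  then show ?case by blast
qed

section \<open>Norms and variance in an eigenbasis\<close>

lemma unitary_diag_index:
  fixes X :: "complex mat"
  assumes "X \<in> carrier_mat m m" "i < m" "j < m"
  shows "(X * mat_diag m g * mat_adjoint X) $$ (i, j) = (\<Sum>k<m. X $$ (i, k) * g k * cnj (X $$ (j, k)))"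
  using assms by (simp add: mat_diag_mult_right[of X m m] scalar_prod_def atLeast0LessThan)

lemma diagonalized_index:
  assumes "unitarily_diagonalizes U d A" "i < dim_row A" "j < dim_row A"
  shows "A $$ (i, j) = (\<Sum>k<dim_row A. U $$ (i, k) * of_real (d k) * cnj (U $$ (j, k)))"
  using assms(1) unitary_diag_index[of U "dim_row A" i j "\<lambda>k. of_real (d k)"] assms(2,3)
  unfolding unitarily_diagonalizes_def by metis

text \<open>As a rewrite rule the equation for \<open>A\<close> in the definition does not terminate, because its right side
  contains \<open>dim_row A\<close>; hence these destruction and introduction rules.\<close>

lemma unitarily_diagonalizesD:
  assumes "unitarily_diagonalizes U d A"
  shows "A \<in> carrier_mat (dim_row A) (dim_row A)" "U \<in> carrier_mat (dim_row A) (dim_row A)"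
    "U * mat_adjoint U = 1\<^sub>m (dim_row A)" "mat_adjoint U * U = 1\<^sub>m (dim_row A)"
    "A = U * mat_diag (dim_row A) (\<lambda>i. of_real (d i)) * mat_adjoint U"
  using assms unfolding unitarily_diagonalizes_def by blast+

lemma unitarily_diagonalizesI:
  assumes "U \<in> carrier_mat n n" "U * mat_adjoint U = 1\<^sub>m n" "mat_adjoint U * U = 1\<^sub>m n"
    "A = U * mat_diag n (\<lambda>i. of_real (d i)) * mat_adjoint U"
  shows "unitarily_diagonalizes U d A" "dim_row A = n"
proof -
  have c: "A \<in> carrier_mat n n" unfolding assms(4) using assms(1) by (auto intro: adjoint_carrier)
  show n: "dim_row A = n" using carrier_matD(1)[OF c] .
  show "unitarily_diagonalizes U d A"
    unfolding unitarily_diagonalizes_def n by (intro conjI c assms)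
qed

lemma diagonalized_hermitian:
  assumes ud: "unitarily_diagonalizes U d A"
  shows "mat_adjoint A = A"
proof (rule eq_matI)
  have A: "dim_col A = dim_row A"
    by (rule carrier_matD(2)[OF unitarily_diagonalizesD(1)[OF ud]])
  fix i j assume "i < dim_row A" "j < dim_col A"
  then have ij: "i < dim_row A" "j < dim_row A" using A by auto
  have "mat_adjoint A $$ (i, j) = cnj (A $$ (j, i))" using ij A by simp
  also have "\<dots> = A $$ (i, j)"
    unfolding diagonalized_index[OF ud ij] diagonalized_index[OF ud ij(2,1)]
    by (simp add: mult_ac)
  finally show "mat_adjoint A $$ (i, j) = A $$ (i, j)" .
qed (use carrier_matD[OF unitarily_diagonalizesD(1)[OF ud]] in simp_all)

lemma diagonalized_herm_fun:
  assumes "unitarily_diagonalizes U d A"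
  shows "unitarily_diagonalizes U (\<lambda>i. f (d i)) (herm_fun f A)" "dim_row (herm_fun f A) = dim_row A"
  using unitarily_diagonalizesI[OF unitarily_diagonalizesD(2-4)[OF assms] herm_fun_eq[OF assms]]
  by blast+

lemma diagonalized_mult:
  assumes A: "unitarily_diagonalizes U d A" and B: "unitarily_diagonalizes U e B"
    and dim: "dim_row B = dim_row A"
  shows "unitarily_diagonalizes U (\<lambda>i. d i * e i) (A * B)"
proof -
  define n where "n = dim_row A"
  define D E where "D = mat_diag n (\<lambda>i. complex_of_real (d i))"
    and "E = mat_diag n (\<lambda>i. complex_of_real (e i))"
  define V where "V = mat_adjoint U"
  have c: "U \<in> carrier_mat n n" "V \<in> carrier_mat n n" "D \<in> carrier_mat n n" "E \<in> carrier_mat n n"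
    using unitarily_diagonalizesD(2)[OF A] unfolding n_def D_def E_def V_def
    by (auto intro: adjoint_carrier)
  have u: "V * U = 1\<^sub>m n" "U * V = 1\<^sub>m n" "A = U * D * V" "B = U * E * V"
    using unitarily_diagonalizesD(3-5)[OF A] unitarily_diagonalizesD(5)[OF B]
    unfolding dim n_def D_def E_def V_def by blast+
  note asc = assoc_mult_mat[of _ n n _ n _ n]
  have mc: "X * Y \<in> carrier_mat n n" if "X \<in> carrier_mat n n" "Y \<in> carrier_mat n n"
    for X Y :: "complex mat" using that by auto
  have "A * B = U * (D * ((V * U) * (E * V)))"
    unfolding u(3,4) using c by (simp add: asc mc)
  also have "\<dots> = U * (D * E) * V" unfolding u(1) using c by (simp add: asc mc)
  also have "D * E = mat_diag n (\<lambda>i. complex_of_real (d i * e i))"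
    unfolding D_def E_def by simp
  finally show ?thesis
    using c(1) u(1,2) unfolding V_def by (intro unitarily_diagonalizesI(1)[of U n])
qed

lemma diagonalized_ntr:
  assumes ud: "unitarily_diagonalizes U d A"
  shows "ntr A = of_real ((\<Sum>k<dim_row A. d k) / dim_row A)"
proof -
  let ?n = "dim_row A"
  have U: "U \<in> carrier_mat ?n ?n" "mat_adjoint U * U = 1\<^sub>m ?n"
    by (rule unitarily_diagonalizesD[OF ud])+
  have "(\<Sum>i<?n. A $$ (i, i)) = (\<Sum>i<?n. \<Sum>k<?n. U $$ (i, k) * of_real (d k) * cnj (U $$ (i, k)))"
    by (intro sum.cong refl diagonalized_index[OF ud]) auto
  also have "\<dots> = (\<Sum>k<?n. \<Sum>i<?n. U $$ (i, k) * of_real (d k) * cnj (U $$ (i, k)))"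
    by (rule sum.swap)
  also have "\<dots> = (\<Sum>k<?n. of_real (d k) * (mat_adjoint U * U) $$ (k, k))"
    using U(1) by (intro sum.cong refl)
      (simp add: scalar_prod_def atLeast0LessThan sum_distrib_left mult_ac)
  also have "\<dots> = of_real (\<Sum>k<?n. d k)" unfolding U(2) by simp
  finally show ?thesis unfolding ntr_def by simp
qed

lemma diagonalized_mat_abs:
  assumes ud: "unitarily_diagonalizes U d A"
  shows "unitarily_diagonalizes U (\<lambda>i. \<bar>d i\<bar>) (mat_abs A)" "dim_row (mat_abs A) = dim_row A"
proof -
  have *: "unitarily_diagonalizes U (\<lambda>i. d i * d i) (mat_adjoint A * A)"
    unfolding diagonalized_hermitian[OF ud] using diagonalized_mult[OF ud ud] by simp
  show "unitarily_diagonalizes U (\<lambda>i. \<bar>d i\<bar>) (mat_abs A)"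
    using diagonalized_herm_fun(1)[OF *, of sqrt] unfolding mat_abs_def by simp
  show "dim_row (mat_abs A) = dim_row A"
    using diagonalized_herm_fun(2)[OF *, of sqrt] carrier_matD[OF unitarily_diagonalizesD(1)[OF ud]]
    unfolding mat_abs_def by simp
qed

lemma diagonalized_Lp_norm:
  assumes ud: "unitarily_diagonalizes U d A" and p: "0 < p"
  shows "Lp_norm p A powr p = (\<Sum>k<dim_row A. \<bar>d k\<bar> powr p) / dim_row A"
proof -
  note abs = diagonalized_mat_abs[OF ud]
  have "Re (ntr (herm_fun (\<lambda>x. x powr p) (mat_abs A))) = (\<Sum>k<dim_row A. \<bar>d k\<bar> powr p) / dim_row A"
    using diagonalized_ntr[OF diagonalized_herm_fun(1)[OF abs(1), of "\<lambda>x. x powr p"]]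
      diagonalized_herm_fun(2)[OF abs(1), of "\<lambda>x. x powr p"] abs(2) by simp
  moreover have "0 \<le> (\<Sum>k<dim_row A. \<bar>d k\<bar> powr p) / dim_row A"
    by (intro divide_nonneg_nonneg sum_nonneg) auto
  ultimately show ?thesis unfolding Lp_norm_def using p by (simp add: powr_powr sum_nonneg)
qed

lemma diagonalized_mat_var:
  assumes ud: "unitarily_diagonalizes U d A"
  shows "mat_var A = (\<Sum>k<dim_row A. (d k)\<^sup>2) / dim_row A - (cmod (ntr A))\<^sup>2"
proof -
  note abs = diagonalized_mat_abs[OF ud]
  have c: "mat_abs A \<in> carrier_mat (dim_row A) (dim_row A)"
    using unitarily_diagonalizesD(1)[OF abs(1)] unfolding abs(2) .
  have "mat_abs A ^\<^sub>m 2 = mat_abs A * mat_abs A"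
    using c by (simp add: numeral_2_eq_2)
  then have "Re (ntr (mat_abs A ^\<^sub>m 2)) = (\<Sum>k<dim_row A. (d k)\<^sup>2) / dim_row A"
    using diagonalized_ntr[OF diagonalized_mult[OF abs(1) abs(1) refl]] abs(2)
    by (simp add: power2_eq_square)
  then show ?thesis unfolding mat_var_def by simp
qed

section \<open>Quadratic forms in an eigenbasis\<close>

text \<open>The columns of \<open>u\<close> are an orthonormal basis of eigenvectors of \<open>f\<close> with eigenvalues \<open>d\<close>. Both
  orthogonality relations are recorded: the one for columns evaluates quadratic forms, the one for
  rows is Parseval's identity.\<close>

definition eigensystem :: "nat \<Rightarrow> entries \<Rightarrow> (nat \<Rightarrow> real) \<Rightarrow> entries \<Rightarrow> bool" where
  "eigensystem n u d f \<longleftrightarrow>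
    (\<forall>k<2^n. \<forall>l<2^n. (\<Sum>i<2^n. cnj (u i k) * u i l) = (if k = l then 1 else 0)) \<and>
    (\<forall>i<2^n. \<forall>j<2^n. (\<Sum>k<2^n. u i k * cnj (u j k)) = (if i = j then 1 else 0)) \<and>
    (\<forall>i<2^n. \<forall>j<2^n. f i j = (\<Sum>k<2^n. u i k * of_real (d k) * cnj (u j k)))"

lemma diagonalized_eigensystem:
  assumes ud: "unitarily_diagonalizes U d A" and A: "A \<in> carrier_mat (2^n) (2^n)"
  shows "eigensystem n (\<lambda>i j. U $$ (i, j)) d (\<lambda>i j. A $$ (i, j))"
proof -
  have U: "U \<in> carrier_mat (2^n) (2^n)" "mat_adjoint U * U = 1\<^sub>m (2^n)" "U * mat_adjoint U = 1\<^sub>m (2^n)"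
    using unitarily_diagonalizesD(2-4)[OF ud] A by auto
  have 1: "(\<Sum>i<2^n. cnj (U $$ (i, k)) * U $$ (i, l)) = (if k = l then 1 else 0)"
    if "k < 2^n" "l < 2^n" for k l
    using arg_cong[OF U(2), of "\<lambda>M. M $$ (k, l)"] that U(1)
    by (simp add: scalar_prod_def atLeast0LessThan)
  have 2: "(\<Sum>k<2^n. U $$ (i, k) * cnj (U $$ (j, k))) = (if i = j then 1 else 0)"
    if "i < 2^n" "j < 2^n" for i j
    using arg_cong[OF U(3), of "\<lambda>M. M $$ (i, j)"] that U(1)
    by (simp add: scalar_prod_def atLeast0LessThan)
  show ?thesis unfolding eigensystem_def
    using 1 2 diagonalized_index[OF ud] A by auto
qed

definition qform :: "nat \<Rightarrow> entries \<Rightarrow> (nat \<Rightarrow> complex) \<Rightarrow> complex" where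
  "qform n f v = (\<Sum>i<2^n. \<Sum>j<2^n. cnj (v i) * f i j * v j)"

definition sqnorm :: "nat \<Rightarrow> (nat \<Rightarrow> complex) \<Rightarrow> real" where
  "sqnorm n v = (\<Sum>i<2^n. (cmod (v i))\<^sup>2)"

definition act :: "nat \<Rightarrow> entries \<Rightarrow> (nat \<Rightarrow> complex) \<Rightarrow> nat \<Rightarrow> complex" where
  "act n f v i = (\<Sum>j<2^n. f i j * v j)"

lemma sqnorm_nonneg [simp]: "0 \<le> sqnorm n v"
  unfolding sqnorm_def by (intro sum_nonneg) auto

lemma qform_act: "qform n f v = (\<Sum>i<2^n. cnj (v i) * act n f v i)"
  unfolding qform_def act_def by (simp add: sum_distrib_left mult.assoc)

lemma eigenvector_sqnorm:
  assumes "eigensystem n u d f" "k < 2^n"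
  shows "sqnorm n (\<lambda>i. u i k) = 1"
proof -
  have "complex_of_real (sqnorm n (\<lambda>i. u i k)) = (\<Sum>i<2^n. cnj (u i k) * u i k)"
    unfolding sqnorm_def of_real_sum by (simp add: complex_norm_square mult.commute del: of_real_power)
  also have "\<dots> = 1" using assms unfolding eigensystem_def by auto
  finally show ?thesis by simp
qed

lemma qform_eigenvector:
  assumes e: "eigensystem n u d f" and k: "k < 2^n"
  shows "qform n f (\<lambda>i. u i k) = of_real (d k)"
proof -
  let ?N = "{..<2^n} :: nat set"
  have "act n f (\<lambda>i. u i k) i = of_real (d k) * u i k" if i: "i \<in> ?N" for i
  proof -
    have "act n f (\<lambda>i. u i k) i = (\<Sum>j\<in>?N. \<Sum>l\<in>?N. u i l * of_real (d l) * cnj (u j l) * u j k)"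
      unfolding act_def sum_distrib_right[symmetric] using e i
      by (intro sum.cong refl) (simp add: eigensystem_def)
    also have "\<dots> = (\<Sum>l\<in>?N. u i l * of_real (d l) * (\<Sum>j\<in>?N. cnj (u j l) * u j k))"
      unfolding sum_distrib_left by (subst sum.swap) (simp add: mult_ac)
    also have "\<dots> = (\<Sum>l\<in>?N. u i l * of_real (d l) * (if l = k then 1 else 0))"
      using e k by (intro sum.cong refl) (simp add: eigensystem_def)
    also have "\<dots> = (\<Sum>l\<in>?N. if l = k then u i l * of_real (d l) else 0)"
      by (intro sum.cong) auto
    also have "\<dots> = of_real (d k) * u i k"
      using k by (simp add: mult.commute)
    finally show ?thesis .
  qed
  then have "qform n f (\<lambda>i. u i k) = of_real (d k) * (\<Sum>i<2^n. cnj (u i k) * u i k)"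
    unfolding qform_act sum_distrib_left by (intro sum.cong refl) (simp add: mult_ac)
  also have "\<dots> = of_real (d k)" using e k by (auto simp: eigensystem_def)
  finally show ?thesis .
qed

lemma eigenvalue_bound:
  assumes e: "eigensystem n u d f" and k: "k < 2^n"
    and b: "\<And>v. cmod (qform n f v) \<le> sqnorm n v"
  shows "\<bar>d k\<bar> \<le> 1"
  using b[of "\<lambda>i. u i k"] unfolding qform_eigenvector[OF e k] eigenvector_sqnorm[OF e k] by simp

lemma ip_eigensystem:
  assumes e: "eigensystem n u d f"
  shows "ip n h f = (\<Sum>k<2^n. of_real (d k) * qform n h (\<lambda>i. u i k)) / 2^n"
proof -
  let ?N = "{..<2^n} :: nat set"
  have "(\<Sum>i\<in>?N. \<Sum>j\<in>?N. h i j * cnj (f i j)) =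
      (\<Sum>i\<in>?N. \<Sum>j\<in>?N. \<Sum>k\<in>?N. of_real (d k) * (cnj (u i k) * h i j * u j k))"
  proof (intro sum.cong refl)
    fix i j assume "i \<in> ?N" "j \<in> ?N"
    then have "f i j = (\<Sum>k\<in>?N. u i k * of_real (d k) * cnj (u j k))"
      using e unfolding eigensystem_def by auto
    then show "h i j * cnj (f i j) = (\<Sum>k\<in>?N. of_real (d k) * (cnj (u i k) * h i j * u j k))"
      by (simp add: sum_distrib_left mult_ac)
  qed
  also have "\<dots> = (\<Sum>i\<in>?N. \<Sum>k\<in>?N. \<Sum>j\<in>?N. of_real (d k) * (cnj (u i k) * h i j * u j k))"
    by (intro sum.cong[OF refl] sum.swap)
  also have "\<dots> = (\<Sum>k\<in>?N. of_real (d k) * qform n h (\<lambda>i. u i k))"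
    unfolding qform_def sum_distrib_left by (rule sum.swap)
  finally show ?thesis unfolding ip_def by simp
qed

lemma frob_eigensystem:
  assumes "eigensystem n u d f"
  shows "frob n f = (\<Sum>k<2^n. (d k)\<^sup>2) / 2^n"
proof -
  have "complex_of_real (frob n f) = of_real ((\<Sum>k<2^n. (d k)\<^sup>2) / 2^n)"
    unfolding frob_ip ip_eigensystem[OF assms]
    by (simp add: qform_eigenvector[OF assms] power2_eq_square)
  then show ?thesis by (simp only: of_real_eq_iff)
qed

lemma norm_qform_le: "(cmod (qform n f v))\<^sup>2 \<le> sqnorm n v * sqnorm n (act n f v)"
proof -
  have "cmod (qform n f v) \<le> (\<Sum>i<2^n. \<bar>cmod (v i)\<bar> * \<bar>cmod (act n f v i)\<bar>)"
    unfolding qform_act by (intro sum_norm_le) (simp add: norm_mult)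
  also have "\<dots> \<le> L2_set (\<lambda>i. cmod (v i)) {..<2^n} * L2_set (\<lambda>i. cmod (act n f v i)) {..<2^n}"
    by (rule L2_set_mult_ineq)
  finally have "(cmod (qform n f v))\<^sup>2 \<le>
      (L2_set (\<lambda>i. cmod (v i)) {..<2^n} * L2_set (\<lambda>i. cmod (act n f v i)) {..<2^n})\<^sup>2"
    by (intro power_mono) auto
  also have "\<dots> = sqnorm n v * sqnorm n (act n f v)"
    unfolding L2_set_def sqnorm_def by (simp add: power_mult_distrib sum_nonneg)
  finally show ?thesis .
qed

text \<open>For Hermitian \<open>h\<close> the squared length of \<open>h v\<close> is the quadratic form of \<open>h\<^sup>2\<close> at \<open>v\<close>.\<close>

lemma sqnorm_act:
  assumes h: "herm n h"
  shows "complex_of_real (sqnorm n (act n h v)) = qform n (mprod n h h) v"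
proof -
  let ?N = "{..<2^n} :: nat set"
  have "complex_of_real (sqnorm n (act n h v)) = (\<Sum>i\<in>?N. cnj (act n h v i) * act n h v i)"
    unfolding sqnorm_def of_real_sum by (simp add: complex_norm_square mult.commute del: of_real_power)
  also have "\<dots> = (\<Sum>i\<in>?N. \<Sum>j\<in>?N. \<Sum>l\<in>?N. cnj (v j) * (h j i * h i l) * v l)"
    unfolding act_def cnj_sum sum_product
    by (intro sum.cong refl) (simp add: hermD[OF h] mult_ac)
  also have "\<dots> = (\<Sum>j\<in>?N. \<Sum>l\<in>?N. \<Sum>i\<in>?N. cnj (v j) * (h j i * h i l) * v l)"
    by (subst sum.swap, rule sum.cong[OF refl], rule sum.swap)
  also have "\<dots> = qform n (mprod n h h) v"
    unfolding qform_def mprod_def sum_distrib_left sum_distrib_right ..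
  finally show ?thesis .
qed

text \<open>The Frobenius norm can be computed in any orthonormal basis.\<close>

lemma sum_sqnorm_act:
  assumes e: "eigensystem n u d f"
  shows "(\<Sum>k<2^n. sqnorm n (act n g (\<lambda>i. u i k))) = 2^n * frob n g"
proof -
  let ?N = "{..<2^n} :: nat set"
  have row: "(\<Sum>k\<in>?N. act n g (\<lambda>i. u i k) i * cnj (act n g (\<lambda>i. u i k) i)) =
      (\<Sum>j\<in>?N. g i j * cnj (g i j))" for i
  proof -
    have "(\<Sum>k\<in>?N. act n g (\<lambda>i. u i k) i * cnj (act n g (\<lambda>i. u i k) i)) =
      (\<Sum>k\<in>?N. \<Sum>j\<in>?N. \<Sum>l\<in>?N. g i j * cnj (g i l) * (u j k * cnj (u l k)))"
      unfolding act_def cnj_sum sum_product by (simp add: mult_ac)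
    also have "\<dots> = (\<Sum>j\<in>?N. \<Sum>l\<in>?N. \<Sum>k\<in>?N. g i j * cnj (g i l) * (u j k * cnj (u l k)))"
      by (subst sum.swap, rule sum.cong[OF refl], rule sum.swap)
    also have "\<dots> = (\<Sum>j\<in>?N. \<Sum>l\<in>?N. if j = l then g i j * cnj (g i l) else 0)"
      unfolding sum_distrib_left[symmetric] using e
      by (intro sum.cong refl) (simp add: eigensystem_def)
    also have "\<dots> = (\<Sum>j\<in>?N. g i j * cnj (g i j))"
      by (intro sum.cong refl) simp
    finally show ?thesis .
  qed
  have "complex_of_real (\<Sum>k<2^n. sqnorm n (act n g (\<lambda>i. u i k))) =
    (\<Sum>k\<in>?N. \<Sum>i\<in>?N. act n g (\<lambda>i. u i k) i * cnj (act n g (\<lambda>i. u i k) i))"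
    unfolding sqnorm_def of_real_sum by (simp add: complex_norm_square del: of_real_power)
  also have "\<dots> = (\<Sum>i\<in>?N. \<Sum>j\<in>?N. g i j * cnj (g i j))"
    by (subst sum.swap) (simp add: row)
  also have "\<dots> = of_real (2^n * frob n g)"
    unfolding of_real_mult frob_ip ip_def by simp
  finally show ?thesis by (simp only: of_real_eq_iff)
qed

text \<open>Cauchy--Schwarz twice: for a unit vector \<open>v\<close>, the fourth power of the quadratic form of \<open>h\<close> is at
  most the squared form of \<open>h\<^sup>2\<close>, which is at most the squared length of \<open>h\<^sup>2 v\<close>. So pinching \<open>h\<close> to the
  diagonal of some orthonormal basis does not increase its 4-norm.\<close>

lemma sum_qform_power4_le:
  assumes e: "eigensystem n u d f" and h: "herm n h"
  shows "(\<Sum>k<2^n. (cmod (qform n h (\<lambda>i. u i k)))^4) \<le> 2^n * frob n (mprod n h h)"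
proof -
  have "(cmod (qform n h (\<lambda>i. u i k)))^4 \<le> sqnorm n (act n (mprod n h h) (\<lambda>i. u i k))"
    if "k < 2^n" for k
  proof -
    let ?v = "\<lambda>i. u i k"
    have 1: "sqnorm n ?v = 1" by (rule eigenvector_sqnorm[OF e that])
    have "(cmod (qform n h ?v))^4 = ((cmod (qform n h ?v))\<^sup>2)\<^sup>2" by (simp flip: power_mult)
    also have "\<dots> \<le> (sqnorm n (act n h ?v))\<^sup>2"
      using norm_qform_le[of n h ?v] 1 by (intro power_mono) auto
    also have "\<dots> = (cmod (qform n (mprod n h h) ?v))\<^sup>2"
      unfolding sqnorm_act[OF h, symmetric] by simp
    also have "\<dots> \<le> sqnorm n (act n (mprod n h h) ?v)"
      using norm_qform_le[of n "mprod n h h" ?v] 1 by simp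
    finally show ?thesis .
  qed
  then have "(\<Sum>k<2^n. (cmod (qform n h (\<lambda>i. u i k)))^4) \<le>
      (\<Sum>k<2^n. sqnorm n (act n (mprod n h h) (\<lambda>i. u i k)))"
    by (intro sum_mono) auto
  then show ?thesis unfolding sum_sqnorm_act[OF e] .
qed

section \<open>Hoelder duality: from the fourth power to exponents below two\<close>

text \<open>The weighted inequality of arithmetic and geometric means for \<open>x\<^sup>q\<close>, \<open>y\<^sup>4\<close> and \<open>1\<close> with weights \<open>1/q\<close>,
  \<open>1/4\<close> and \<open>3/4 - 1/q\<close>; the last weight is nonnegative exactly when \<open>q \<ge> 4/3\<close>.\<close>

lemma young_three_terms:
  fixes x y q :: real
  assumes "0 \<le> x" "0 \<le> y" "4/3 \<le> q"
  shows "x * y \<le> x powr q / q + y^4 / 4 + (3/4 - 1/q)"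
proof (cases "y = 0")
  case True
  have "1 / q \<le> 3 / 4" using assms by (simp add: field_simps)
  moreover have "0 \<le> x powr q / q" using assms by simp
  ultimately show ?thesis using True by simp
next
  case False
  \<comment> \<open>the exponent conjugate to \<open>q\<close>\<close>
  define r where "r = q / (q - 1)"
  have r: "1 < r" "r \<le> 4" "1 / q + 1 / r = 1" "0 < r"
    using assms unfolding r_def by (auto simp: field_simps)
  have "y powr r = (y^4) powr (r/4) * 1 powr (1 - r/4)"
    using assms by (simp add: powr_powr flip: powr_numeral)
  also have "\<dots> \<le> r/4 * y^4 + (1 - r/4) * 1"
    using r assms False by (intro Youngs_inequality_0) auto
  finally have "y powr r / r \<le> (r/4 * y^4 + (1 - r/4)) / r"
    using r by (intro divide_right_mono) auto
  also have "\<dots> = y^4 / 4 + (1 / r - 1/4)" using r by (simp add: field_simps)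
  finally have "y powr r / r \<le> y^4 / 4 + (3/4 - 1/q)" using r(3) by simp
  moreover have "x * y \<le> x powr q / q + y powr r / r"
    using r assms by (intro Youngs_inequality) auto
  ultimately show ?thesis by simp
qed

text \<open>Averages, not sums: the exponents \<open>1/q\<close> and \<open>1/4\<close> add up to at most one, and the missing exponent
  falls on the constant function one.\<close>

lemma Holder_average:
  fixes a b :: "nat \<Rightarrow> real"
  assumes nn: "\<And>k. 0 \<le> a k" "\<And>k. 0 \<le> b k" and q: "4/3 \<le> q" and N: "0 < N"
  shows "(\<Sum>k<N. a k * b k) / real N
    \<le> ((\<Sum>k<N. a k powr q) / real N) powr (1/q) * ((\<Sum>k<N. b k ^ 4) / real N) powr (1/4)"
proof -
  define A where "A = (\<Sum>k<N. a k powr q) / real N"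
  define B where "B = (\<Sum>k<N. b k ^ 4) / real N"
  have AB: "0 \<le> A" "0 \<le> B" unfolding A_def B_def using nn by (auto intro!: divide_nonneg_nonneg sum_nonneg)
  show ?thesis
  proof (cases "A = 0 \<or> B = 0")
    case True
    then have "(\<Sum>k<N. a k powr q) = 0 \<or> (\<Sum>k<N. b k ^ 4) = 0"
      using N unfolding A_def B_def by auto
    then have "(\<forall>k<N. a k = 0) \<or> (\<forall>k<N. b k = 0)"
      using nn by (auto simp: sum_nonneg_eq_0_iff)
    then have "(\<Sum>k<N. a k * b k) = 0" by (auto intro!: sum.neutral)
    then show ?thesis by simp
  next
    case False
    define \<alpha> \<beta> where "\<alpha> = A powr (1/q)" and "\<beta> = B powr (1/4)"
    have pos: "0 < A" "0 < B" using AB False by auto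
    have ab: "0 < \<alpha>" "0 < \<beta>" using pos unfolding \<alpha>_def \<beta>_def by auto
    have \<alpha>: "\<alpha> powr q = A" and \<beta>: "\<beta> ^ 4 = B"
      using pos q unfolding \<alpha>_def \<beta>_def by (simp_all add: powr_powr flip: powr_numeral)
    have "(\<Sum>k<N. a k / \<alpha> * (b k / \<beta>)) \<le>
        (\<Sum>k<N. a k powr q / A / q + b k ^ 4 / B / 4 + (3/4 - 1/q))"
    proof (rule sum_mono)
      fix k
      show "a k / \<alpha> * (b k / \<beta>) \<le> a k powr q / A / q + b k ^ 4 / B / 4 + (3/4 - 1/q)"
        using young_three_terms[of "a k / \<alpha>" "b k / \<beta>" q] nn ab q
        by (simp add: powr_divide power_divide \<alpha> \<beta> less_imp_le)
    qed
    also have "\<dots> = (real N * A) / A / q + (real N * B) / B / 4 + real N * (3/4 - 1/q)"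
    proof -
      have "(\<Sum>k<N. a k powr q) = real N * A" "(\<Sum>k<N. b k ^ 4) = real N * B"
        using N unfolding A_def B_def by simp_all
      then show ?thesis by (simp add: sum.distrib flip: sum_divide_distrib)
    qed
    also have "\<dots> = real N" using pos q by (simp add: field_simps)
    finally have "(\<Sum>k<N. a k * b k) / (\<alpha> * \<beta>) \<le> real N"
      by (simp add: sum_divide_distrib)
    then have "(\<Sum>k<N. a k * b k) / real N \<le> \<alpha> * \<beta>"
      using ab N by (simp add: field_simps)
    then show ?thesis unfolding \<alpha>_def \<beta>_def A_def B_def .
  qed
qed

text \<open>Let \<open>g\<close> be \<open>f\<close> after noise. The damped energy \<open>\<nu>\<close> equals the inner product of \<open>g\<close> and \<open>f\<close>, which
  in an eigenbasis of \<open>f\<close> is the average of eigenvalues of \<open>f\<close> times diagonal entries of \<open>g\<close>. Hoelder's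
  inequality bounds it by the \<open>q\<close>-norm of \<open>f\<close> times the 4-norm of \<open>g\<close>, and hypercontractivity bounds
  the latter by \<open>\<nu>\<^bsup>1/2\<^esup>\<close>. Cancelling \<open>\<nu>\<^bsup>1/2\<^esup>\<close> and squaring gives the claim.\<close>

lemma energy_le_Lq:
  assumes e: "eigensystem n u d f" and h: "herm n f" and q: "4/3 \<le> q"
  shows "energy n (\<lambda>k. (1/5) ^ k) f \<le> ((\<Sum>k<2^n. \<bar>d k\<bar> powr q) / 2^n) powr (2/q)"
proof -
  define g where "g = noise (1/5) n f"
  define \<nu> where "\<nu> = energy n (\<lambda>k. (1/5) ^ k) f"
  define D where "D = ((\<Sum>k<2^n. \<bar>d k\<bar> powr q) / 2^n) powr (1/q)"
  have \<nu>0: "0 \<le> \<nu>" unfolding \<nu>_def by (rule energy_nonneg) simp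
  have g: "herm n g" unfolding g_def by (rule herm_noise[OF h])
  have "\<nu> = cmod (ip n g f)" unfolding g_def ip_noise \<nu>_def[symmetric] using \<nu>0 by simp
  also have "\<dots> \<le> (\<Sum>k<2^n. \<bar>d k\<bar> * cmod (qform n g (\<lambda>i. u i k))) / 2^n"
    unfolding ip_eigensystem[OF e] norm_divide
    by (simp add: norm_power divide_right_mono sum_norm_le norm_mult)
  also have "\<dots> \<le> D * ((\<Sum>k<2^n. cmod (qform n g (\<lambda>i. u i k)) ^ 4) / 2^n) powr (1/4)"
    using Holder_average[of "\<lambda>k. \<bar>d k\<bar>" "\<lambda>k. cmod (qform n g (\<lambda>i. u i k))" q "2^n"] q
    unfolding D_def by simp
  also have "\<dots> \<le> D * (\<nu>\<^sup>2) powr (1/4)"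
  proof -
    have "(\<Sum>k<2^n. cmod (qform n g (\<lambda>i. u i k)) ^ 4) / 2^n \<le> frob n (mprod n g g)"
      using sum_qform_power4_le[OF e g] by (simp add: field_simps)
    also have "\<dots> = (L4_sq n g)\<^sup>2" unfolding L4_sq_def by simp
    also have "\<dots> \<le> \<nu>\<^sup>2"
      unfolding g_def \<nu>_def by (intro power_mono hypercontractivity h) auto
    finally show ?thesis unfolding D_def
      by (intro mult_left_mono powr_mono2) (auto intro!: divide_nonneg_nonneg sum_nonneg)
  qed
  also have "(\<nu>\<^sup>2) powr (1/4) = sqrt \<nu>"
    using \<nu>0 by (simp add: powr_half_sqrt[symmetric] powr_powr flip: powr_numeral)
  finally have "sqrt \<nu> * sqrt \<nu> \<le> D * sqrt \<nu>" using \<nu>0 by simp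
  then have "sqrt \<nu> \<le> D"
  proof (cases "\<nu> = 0")
    case False
    with \<nu>0 have "0 < sqrt \<nu>" by simp
    with \<open>sqrt \<nu> * sqrt \<nu> \<le> D * sqrt \<nu>\<close> show ?thesis by (rule mult_right_le_imp_le)
  qed (simp add: D_def)
  then have "(sqrt \<nu>)\<^sup>2 \<le> D\<^sup>2" using \<nu>0 by (intro power_mono) auto
  also have "D\<^sup>2 = ((\<Sum>k<2^n. \<bar>d k\<bar> powr q) / 2^n) powr (2/q)"
    unfolding D_def by (simp add: powr_powr flip: powr_numeral)
  finally show ?thesis using \<nu>0 unfolding \<nu>_def by simp
qed

section \<open>Matrices between zero and one\<close>

lemma flip_bit_less: "m < n \<Longrightarrow> r < 2^n \<Longrightarrow> flip_bit m r < 2^n" for r :: nat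
  using take_bit_flip_bit_eq[of n m r] by (metis not_le take_bit_nat_eq_self_iff)

lemma flip_bit_flip_bit: "flip_bit m (flip_bit m r) = r" for r :: nat
  by (rule bit_eqI) (auto simp: bit_flip_bit_iff)

lemma herm_bit_deriv:
  assumes "herm n f" "m < n"
  shows "herm n (bit_deriv m f)"
  by (rule hermI) (use assms in \<open>simp add: bit_deriv_def hermD flip_bit_less\<close>)

lemma sum_flip_bit:
  assumes "m < n"
  shows "(\<Sum>r<2^n. g (flip_bit m r)) = (\<Sum>r<(2::nat)^n. g r)"
  by (rule sum.reindex_bij_witness[of _ "flip_bit m" "flip_bit m"])
    (use assms in \<open>auto simp: flip_bit_less flip_bit_flip_bit\<close>)

lemma qform_flip_bit:
  assumes "m < n"
  shows "qform n (\<lambda>r s. f (flip_bit m r) (flip_bit m s)) v = qform n f (\<lambda>r. v (flip_bit m r))"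
proof -
  have "qform n f (\<lambda>r. v (flip_bit m r)) = (\<Sum>r<2^n. \<Sum>s<2^n.
      cnj (v (flip_bit m (flip_bit m r))) * f (flip_bit m r) (flip_bit m s) * v (flip_bit m (flip_bit m s)))"
    unfolding qform_def
    by (subst sum_flip_bit[OF assms, symmetric], rule sum.cong[OF refl],
      subst sum_flip_bit[OF assms, symmetric], rule refl)
  then show ?thesis unfolding flip_bit_flip_bit qform_def by simp
qed

lemma sqnorm_flip_bit: "m < n \<Longrightarrow> sqnorm n (\<lambda>r. v (flip_bit m r)) = sqnorm n v"
  unfolding sqnorm_def by (rule sum_flip_bit)

text \<open>The operator inequalities \<open>0 \<le> f \<le> 1\<close>, through quadratic forms. The order on complex numbers
  makes the form real.\<close>

definition effect :: "nat \<Rightarrow> entries \<Rightarrow> bool" where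
  "effect n f \<longleftrightarrow> (\<forall>v. 0 \<le> qform n f v \<and> qform n f v \<le> of_real (sqnorm n v))"

text \<open>Averaging over one tensor factor is the mean of conjugations by the four Pauli matrices, here
  realized by the sign \<open>e\<close> of bit \<open>m\<close> and the flip of bit \<open>m\<close>. Hence the average of \<open>f\<close> lies between \<open>0\<close>
  and \<open>1\<close> together with \<open>f\<close>, and a difference of two such matrices has its forms in \<open>[-1, 1]\<close>.\<close>

lemma norm_qform_bit_deriv_le:
  assumes f: "effect n f" and m: "m < n"
  shows "cmod (qform n (bit_deriv m f) v) \<le> sqnorm n v"
proof -
  define e where "e r = (if bit r m then - 1 else 1 :: complex)" for r :: nat
  have cnj_e: "cnj (e r) = e r" and norm_e: "cmod (e r) = 1" for r by (auto simp: e_def)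
  define g where "g = (\<lambda>r s. f (flip_bit m r) (flip_bit m s))"
  have deriv: "bit_deriv m f r s = f r s - (f r s + e r * e s * f r s + g r s + e r * e s * g r s) / 4" for r s
    by (auto simp: bit_deriv_def e_def g_def field_simps)
  have qfe: "qform n (\<lambda>r s. e r * e s * h r s) v = qform n h (\<lambda>r. e r * v r)" for h v
    unfolding qform_def by (simp add: cnj_e mult_ac)
  have "qform n (bit_deriv m f) v = qform n f v - (qform n f v + qform n (\<lambda>r s. e r * e s * f r s) v
      + qform n g v + qform n (\<lambda>r s. e r * e s * g r s) v) / 4"
    unfolding qform_def sum_divide_distrib sum.distrib[symmetric] sum_subtractf[symmetric] deriv
    by (intro sum.cong refl) (simp add: field_simps)
  then have eq: "qform n (bit_deriv m f) v = qform n f v - (qform n f v + qform n f (\<lambda>r. e r * v r)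
      + qform n f (\<lambda>r. v (flip_bit m r)) + qform n f (\<lambda>r. e (flip_bit m r) * v (flip_bit m r))) / 4"
    unfolding qfe unfolding g_def qform_flip_bit[OF m] .
  have sq: "sqnorm n (\<lambda>r. e r * v r) = sqnorm n v" "sqnorm n (\<lambda>r. v (flip_bit m r)) = sqnorm n v"
    "sqnorm n (\<lambda>r. e (flip_bit m r) * v (flip_bit m r)) = sqnorm n v"
    using sqnorm_flip_bit[OF m, of v] by (simp_all add: sqnorm_def norm_mult norm_e)
  have bounds: "Im (qform n f w) = 0" "0 \<le> Re (qform n f w)" "Re (qform n f w) \<le> sqnorm n w" for w
    using f by (auto simp: effect_def less_eq_complex_def)
  have "Im (qform n (bit_deriv m f) v) = 0" unfolding eq by (simp add: bounds(1))
  moreover have "\<bar>Re (qform n (bit_deriv m f) v)\<bar> \<le> sqnorm n v"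
  proof -
    have "\<bar>x - (x + a + b + c) / 4\<bar> \<le> s" if "0 \<le> x" "x \<le> s" "0 \<le> a" "a \<le> s" "0 \<le> b" "b \<le> s"
      "0 \<le> c" "c \<le> s" for x a b c s :: real
      using that by (simp add: abs_le_iff field_simps)
    from this[OF bounds(2,3)[of v] bounds(2,3)[of "\<lambda>r. e r * v r", unfolded sq]
        bounds(2,3)[of "\<lambda>r. v (flip_bit m r)", unfolded sq]
        bounds(2,3)[of "\<lambda>r. e (flip_bit m r) * v (flip_bit m r)", unfolded sq]]
    show ?thesis unfolding eq by simp
  qed
  ultimately show ?thesis by (simp add: cmod_eq_Re)
qed

text \<open>Polarization: the form is real at the combinations \<open>e\<^sub>i + e\<^sub>j\<close> and \<open>e\<^sub>i + \<i> e\<^sub>j\<close> of unit vectors, which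
  determines the imaginary and the real part of \<open>f i j - cnj (f j i)\<close>.\<close>

lemma effect_herm:
  assumes "effect n f"
  shows "herm n f"
proof -
  have re: "Im (qform n f v) = 0" for v
    using assms by (auto simp: effect_def less_eq_complex_def)
  have diag: "Im (f i i) = 0" if i: "i < 2^n" for i
  proof -
    define v where "v r = (if r = i then 1 else 0 :: complex)" for r
    have "qform n f v = (\<Sum>r<2^n. \<Sum>s<2^n. if s = i then (if r = i then f r s else 0) else 0)"
      unfolding qform_def v_def by (intro sum.cong refl) auto
    also have "\<dots> = f i i" using i by simp
    finally show ?thesis using re[of v] by simp
  qed
  have "cnj (f i j) = f j i" if ij: "i < 2^n" "j < 2^n" for i j
  proof (cases "i = j")
    case True
    then show ?thesis using diag[OF ij(1)] by (simp add: complex_eq_iff)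
  next
    case False
    have *: "qform n f (\<lambda>r. if r = i then 1 else if r = j then b else 0) =
        f i i + b * f i j + cnj b * f j i + cnj b * b * f j j" for b
    proof -
      let ?v = "\<lambda>r. if r = i then 1 else if r = j then b else 0"
      have S: "(\<Sum>s<2^n. g s * ?v s) = g i + g j * b" for g :: "nat \<Rightarrow> complex"
      proof -
        have "(\<Sum>s<2^n. g s * ?v s) =
            (\<Sum>s<2^n. (if s = i then g s else 0) + (if s = j then g s * b else 0))"
          using False by (intro sum.cong refl) auto
        then show ?thesis using ij by (simp add: sum.distrib)
      qed
      have "qform n f ?v = (\<Sum>r<2^n. (f r i + f r j * b) * cnj (?v r))"
        unfolding qform_act act_def S by (simp add: mult.commute)
      also have "\<dots> = cnj (\<Sum>r<2^n. cnj (f r i + f r j * b) * ?v r)"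
        unfolding cnj_sum by (intro sum.cong refl) auto
      also have "\<dots> = f i i + f i j * b + (f j i + f j j * b) * cnj b"
        unfolding S by simp
      finally show ?thesis by (simp add: algebra_simps)
    qed
    have "Im (f i j) + Im (f j i) = 0"
      using re[of "\<lambda>r. if r = i then 1 else if r = j then 1 else 0"] diag ij
      unfolding *[of 1] by simp
    moreover have "Re (f i j) = Re (f j i)"
      using re[of "\<lambda>r. if r = i then 1 else if r = j then \<i> else 0"] diag ij
      unfolding *[of \<i>] by simp
    ultimately show ?thesis by (simp add: complex_eq_iff)
  qed
  then show ?thesis by (rule hermI)
qed

lemma psd_qform:
  assumes "psd A" "A \<in> carrier_mat (2^n) (2^n)"
  shows "0 \<le> qform n (\<lambda>i j. A $$ (i, j)) v"
proof -
  have "(A *\<^sub>v vec (2^n) v) \<bullet>c vec (2^n) v = qform n (\<lambda>i j. A $$ (i, j)) v"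
    unfolding qform_act act_def using assms(2)
    by (simp add: scalar_prod_def atLeast0LessThan mult.commute)
  moreover have "0 \<le> (A *\<^sub>v vec (2^n) v) \<bullet>c vec (2^n) v"
    using assms unfolding psd_def by auto
  ultimately show ?thesis by simp
qed

lemma loewner_effect:
  assumes T: "T \<in> carrier_mat (2^n) (2^n)"
    and "loewner_le (0\<^sub>m (2^n) (2^n)) T" "loewner_le T (1\<^sub>m (2^n))"
  shows "effect n (\<lambda>i j. T $$ (i, j))"
  unfolding effect_def
proof (intro allI conjI)
  fix v
  have p: "psd (T - 0\<^sub>m (2^n) (2^n))" "psd (1\<^sub>m (2^n) - T)"
    using assms unfolding loewner_le_def by auto
  have "qform n (\<lambda>i j. (T - 0\<^sub>m (2^n) (2^n)) $$ (i, j)) v = qform n (\<lambda>i j. T $$ (i, j)) v"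
    unfolding qform_def using T by simp
  moreover have "0 \<le> qform n (\<lambda>i j. (T - 0\<^sub>m (2^n) (2^n)) $$ (i, j)) v"
    using p(1) T by (intro psd_qform) auto
  ultimately show "0 \<le> qform n (\<lambda>i j. T $$ (i, j)) v" by simp
  have "qform n (\<lambda>i j. (1\<^sub>m (2^n) - T) $$ (i, j)) v =
      (\<Sum>i<2^n. \<Sum>j<2^n. (if j = i then cnj (v i) * v j else 0) - cnj (v i) * T $$ (i, j) * v j)"
    unfolding qform_def using T by (intro sum.cong refl) (auto simp: algebra_simps)
  also have "\<dots> = (\<Sum>i<2^n. cnj (v i) * v i) - qform n (\<lambda>i j. T $$ (i, j)) v"
    unfolding sum_subtractf qform_def by simp
  also have "(\<Sum>i<2^n. cnj (v i) * v i) = of_real (sqnorm n v)"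
    unfolding sqnorm_def of_real_sum by (simp add: complex_norm_square mult.commute del: of_real_power)
  finally show "qform n (\<lambda>i j. T $$ (i, j)) v \<le> of_real (sqnorm n v)"
    using psd_qform[OF p(2) minus_carrier_mat[OF T], of v] by simp
qed

lemma effect_norm_qform: "effect n f \<Longrightarrow> cmod (qform n f v) \<le> sqnorm n v"
  by (auto simp: effect_def less_eq_complex_def cmod_eq_Re)

section \<open>The tensor definition of the partial derivatives\<close>

lemma sum_delta_pair:
  fixes g :: "nat \<Rightarrow> nat \<Rightarrow> complex"
  assumes "k0 < b" "l0 < b"
  shows "(\<Sum>k<b. \<Sum>l<b. g k l * (if k0 = k \<and> l0 = l then 1 else 0)) = g k0 l0"
proof -
  have "(\<Sum>k<b. \<Sum>l<b. g k l * (if k0 = k \<and> l0 = l then 1 else 0)) =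
      (\<Sum>k<b. \<Sum>l<b. if l = l0 then (if k = k0 then g k l else 0) else 0)"
    by (intro sum.cong refl) auto
  then show ?thesis using assms by simp
qed

text \<open>Applying \<open>\<Phi> \<otimes> id\<close> amounts to applying \<open>\<Phi>\<close> separately to each of the \<open>a \<times> a\<close> matrices obtained by
  fixing the position inside the second factor.\<close>

lemma tensor_map_id_right:
  assumes lin: "lin_on a \<Phi>" and rs: "r < a * b" "s < a * b"
  shows "tensor_map a b \<Phi> id T $$ (r, s) =
    \<Phi> (mat a a (\<lambda>(i, j). T $$ (i * b + r mod b, j * b + s mod b))) $$ (r div b, s div b)"
proof -
  have b: "0 < b" using rs by (cases b) auto
  have dm: "r div b < a" "s div b < a" "r mod b < b" "s mod b < b"
    using rs b by (auto simp: less_mult_imp_div_less)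
  have c: "\<Phi> (mat_unit a i j) \<in> carrier_mat a a" for i j
    using lin unfolding lin_on_def mat_unit_def by auto
  have "tensor_map a b \<Phi> id T $$ (r, s) = (\<Sum>i<a. \<Sum>j<a. \<Sum>k<b. \<Sum>l<b.
      (T $$ (i * b + k, j * b + l) * \<Phi> (mat_unit a i j) $$ (r div b, s div b)) *
      (if r mod b = k \<and> s mod b = l then 1 else 0))"
    unfolding tensor_map_def using rs dm carrier_matD[OF c]
    by (simp add: kron_def mat_unit_def mult.assoc)
  also have "\<dots> = (\<Sum>i<a. \<Sum>j<a. T $$ (i * b + r mod b, j * b + s mod b) *
      \<Phi> (mat_unit a i j) $$ (r div b, s div b))"
    by (intro sum.cong refl sum_delta_pair dm)
  also have "\<dots> = \<Phi> (mat a a (\<lambda>(i, j). T $$ (i * b + r mod b, j * b + s mod b))) $$ (r div b, s div b)"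
    using dm by (subst lin_on_expand[OF lin]) auto
  finally show ?thesis .
qed

text \<open>The mirror image: \<open>id \<otimes> \<Psi>\<close> acts separately on each \<open>b \<times> b\<close> block.\<close>

lemma tensor_map_id_left:
  assumes lin: "lin_on b \<Psi>" and rs: "r < a * b" "s < a * b"
  shows "tensor_map a b id \<Psi> T $$ (r, s) =
    \<Psi> (mat b b (\<lambda>(k, l). T $$ (r div b * b + k, s div b * b + l))) $$ (r mod b, s mod b)"
proof -
  have b: "0 < b" using rs by (cases b) auto
  have dm: "r div b < a" "s div b < a" "r mod b < b" "s mod b < b"
    using rs b by (auto simp: less_mult_imp_div_less)
  have c: "\<Psi> (mat_unit b i j) \<in> carrier_mat b b" for i j
    using lin unfolding lin_on_def mat_unit_def by auto
  have "tensor_map a b id \<Psi> T $$ (r, s) = (\<Sum>i<a. \<Sum>j<a.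
      (\<Sum>k<b. \<Sum>l<b. T $$ (i * b + k, j * b + l) * \<Psi> (mat_unit b k l) $$ (r mod b, s mod b)) *
      (if r div b = i \<and> s div b = j then 1 else 0))"
    unfolding tensor_map_def sum_distrib_right using rs dm carrier_matD[OF c]
    by (simp add: kron_def mat_unit_def mult_ac)
  also have "\<dots> = (\<Sum>k<b. \<Sum>l<b. T $$ (r div b * b + k, s div b * b + l) *
      \<Psi> (mat_unit b k l) $$ (r mod b, s mod b))"
    by (rule sum_delta_pair[OF dm(1,2)])
  also have "\<dots> = \<Psi> (mat b b (\<lambda>(k, l). T $$ (r div b * b + k, s div b * b + l))) $$ (r mod b, s mod b)"
    using dm by (subst lin_on_expand[OF lin]) auto
  finally show ?thesis .
qed

lemma flip_bit_div_mod: "flip_bit m r = flip_bit 0 (r div 2^m) * 2^m + r mod 2^m" for r :: nat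
proof (induction m arbitrary: r)
  case (Suc m)
  have "r mod 2 ^ Suc m = 2 * (r div 2 mod 2^m) + r mod 2"
    by (simp add: mod_mult2_eq)
  then show ?case
    unfolding flip_bit_Suc Suc.IH[of "r div 2"] by (simp add: div_mult2_eq)
qed simp

lemma partial_d_carrier:
  assumes "1 \<le> j" "j \<le> n"
  shows "partial_d n j T \<in> carrier_mat (2^n) (2^n)"
proof -
  have "(2::nat) ^ (j - 1) * 2 * 2 ^ (n - j) = 2 ^ n"
    using assms by (simp flip: power_Suc2 power_add)
  then show ?thesis unfolding partial_d_def tensor_map_def by (metis mat_carrier)
qed

text \<open>The first tensor factor corresponds to the highest bit of an index, so the \<open>j\<close>-th factor is bit
  \<open>n - j\<close>.\<close>

lemma partial_d_index:
  assumes j: "1 \<le> j" "j \<le> n" and rs: "r < 2^n" "s < 2^n"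
  shows "partial_d n j T $$ (r, s) = bit_deriv (n - j) (\<lambda>r s. T $$ (r, s)) r s"
proof -
  define b where "b = (2::nat) ^ (n - j)"
  define a where "a = (2::nat) ^ (j - 1)"
  have ab: "a * 2 * b = 2^n"
    using j unfolding a_def b_def by (simp flip: power_Suc2 power_add)
  have rs': "r < a * 2 * b" "s < a * 2 * b" using rs ab by auto
  define \<rho> \<sigma> where "\<rho> = r div b" and "\<sigma> = s div b"
  have \<rho>\<sigma>: "\<rho> < a * 2" "\<sigma> < a * 2"
    using rs' unfolding \<rho>_def \<sigma>_def by (auto simp: less_mult_imp_div_less)
  define M where "M = mat (a * 2) (a * 2) (\<lambda>(i, j). T $$ (i * b + r mod b, j * b + s mod b))"
  define X where "X = mat 2 2 (\<lambda>(k, l). M $$ (\<rho> div 2 * 2 + k, \<sigma> div 2 * 2 + l))"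
  have lt: "\<tau> div 2 * 2 + k < a * 2" if "k < 2" "\<tau> < a * 2" for k \<tau>
    using that by presburger
  have X: "X $$ (k, l) = T $$ ((\<rho> div 2 * 2 + k) * b + r mod b, (\<sigma> div 2 * 2 + l) * b + s mod b)"
    if "k < 2" "l < 2" for k l
    unfolding X_def M_def using that \<rho>\<sigma> by (simp add: lt)
  have "partial_d n j T $$ (r, s) = tensor_map a 2 id D_map M $$ (\<rho>, \<sigma>)"
    unfolding partial_d_def a_def[symmetric] b_def[symmetric] M_def \<rho>_def \<sigma>_def
    by (rule tensor_map_id_right[OF lin_on_tensor_map rs'])
  also have "\<dots> = D_map X $$ (\<rho> mod 2, \<sigma> mod 2)"
    unfolding X_def by (rule tensor_map_id_left[OF lin_on_D_map \<rho>\<sigma>])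
  also have "\<dots> = X $$ (\<rho> mod 2, \<sigma> mod 2)
      - (if \<rho> mod 2 = \<sigma> mod 2 then (X $$ (0, 0) + X $$ (1, 1)) / 2 else 0)"
    unfolding D_map_def ntr_def by (simp add: X_def numeral_2_eq_2)
  also have "X $$ (\<rho> mod 2, \<sigma> mod 2) = T $$ (r, s)"
    by (simp add: X \<rho>_def \<sigma>_def)
  also have "(if \<rho> mod 2 = \<sigma> mod 2 then (X $$ (0, 0) + X $$ (1, 1)) / 2 else 0) =
      (if \<rho> mod 2 = \<sigma> mod 2 then (T $$ (r, s) + T $$ (flip_bit (n - j) r, flip_bit (n - j) s)) / 2 else 0)"
  proof (cases "\<rho> mod 2 = \<sigma> mod 2")
    case True
    have fl: "flip_bit (n - j) r = flip_bit 0 \<rho> * b + r mod b"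
      "flip_bit (n - j) s = flip_bit 0 \<sigma> * b + s mod b"
      unfolding \<rho>_def \<sigma>_def b_def by (rule flip_bit_div_mod)+
    have d: "r = \<rho> * b + r mod b" "s = \<sigma> * b + s mod b" unfolding \<rho>_def \<sigma>_def by simp_all
    have "X $$ (0, 0) + X $$ (1, 1) = T $$ (\<rho> * b + r mod b, \<sigma> * b + s mod b)
        + T $$ (flip_bit 0 \<rho> * b + r mod b, flip_bit 0 \<sigma> * b + s mod b)"
    proof (cases "even \<rho>")
      case e: True
      then have "even \<sigma>" using True by (metis even_iff_mod_2_eq_zero)
      with e have "\<rho> div 2 * 2 = \<rho>" "\<sigma> div 2 * 2 = \<sigma>" "flip_bit 0 \<rho> = Suc \<rho>" "flip_bit 0 \<sigma> = Suc \<sigma>"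
        by (auto simp: flip_bit_0)
      then show ?thesis by (simp add: X)
    next
      case e: False
      then have "odd \<sigma>" using True by (metis even_iff_mod_2_eq_zero)
      moreover have "Suc (\<tau> div 2 * 2) = \<tau>" "flip_bit 0 \<tau> = \<tau> div 2 * 2" if "odd \<tau>" for \<tau> :: nat
        using that by (presburger, simp add: flip_bit_0 mult.commute[of _ 2])
      ultimately have "Suc (\<rho> div 2 * 2) = \<rho>" "Suc (\<sigma> div 2 * 2) = \<sigma>"
        "flip_bit 0 \<rho> = \<rho> div 2 * 2" "flip_bit 0 \<sigma> = \<sigma> div 2 * 2"
        using e by blast+
      then show ?thesis using X[of 0 0] X[of 1 1] by (simp del: mult_Suc)
    qed
    with True show ?thesis unfolding fl d[symmetric] by simp
  qed simp
  also have "T $$ (r, s) - \<dots> = bit_deriv (n - j) (\<lambda>r s. T $$ (r, s)) r s"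
  proof -
    have "bit r (n - j) = bit s (n - j) \<longleftrightarrow> \<rho> mod 2 = \<sigma> mod 2"
      unfolding bit_iff_odd \<rho>_def \<sigma>_def b_def by (auto simp: mod_2_eq_odd)
    then show ?thesis by (auto simp: bit_deriv_def field_simps)
  qed
  finally show ?thesis .
qed

section \<open>Balancing low and high weights\<close>

text \<open>For \<open>M \<ge> n\<^bsup>-1/2\<^esup>\<close> the elementary bound \<open>ln n \<le> 2 n\<^bsup>1/2\<^esup>\<close> suffices. For smaller \<open>M\<close> put
  \<open>x = (2 - q) ln n\<close>; the factor \<open>M\<^bsup>2/q - 1\<^esup>\<close> is at most \<open>exp (- x / 4)\<close>, and \<open>K = x / 16\<close> makes
  \<open>5\<^sup>K \<le> exp (x / 8)\<close>, since \<open>5 \<le> exp 2\<close>. The half of the gain that is left over is at most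
  \<open>8 / x\<close>.\<close>

lemma dichotomy_bound:
  fixes n V M q :: real
  assumes n: "2 \<le> n" and q: "1 \<le> q" "q < 2" and V: "0 \<le> V" "V \<le> 1" and M: "0 \<le> M"
    and bound: "\<And>K. 0 < K \<Longrightarrow> V \<le> 5 powr K * (n * M powr (2/q)) + n * M / K"
  shows "(2 - q) * V * ln n / n \<le> 24 * M"
proof -
  have ln: "0 < ln n" using n by simp
  define x where "x = (2 - q) * ln n"
  have x: "0 < x" unfolding x_def using q ln by simp
  show ?thesis
  proof (cases "M < n powr (-1/2)")
    case False
    have "ln (sqrt n) \<le> sqrt n" using n by (intro ln_bound) auto
    then have "ln n \<le> 2 * sqrt n" using n by (simp add: ln_sqrt)
    moreover have "(2 - q) * V \<le> 1"
      using q V mult_mono[of "2 - q" 1 V 1] by simp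
    ultimately have "(2 - q) * V * ln n \<le> 2 * sqrt n"
      using mult_right_mono[of "(2 - q) * V" 1 "ln n"] ln by linarith
    then have "(2 - q) * V * ln n / n \<le> 2 * sqrt n / n"
      using n by (intro divide_right_mono) auto
    also have "\<dots> = 2 * n powr (-1/2)"
      using n by (simp add: powr_minus powr_half_sqrt field_simps)
    also have "\<dots> \<le> 24 * M" using False M by linarith
    finally show ?thesis .
  next
    case True
    define K where "K = x / 16"
    have K: "0 < K" using x unfolding K_def by simp
    have gain: "M powr (2/q) \<le> M * exp (- x / 4)"
    proof (cases "M = 0")
      case False
      have "M powr (2/q) = M powr 1 * M powr ((2 - q) / q)"
      proof -
        have "2 / q = 1 + (2 - q) / q" using q by (simp add: field_simps)
        then show ?thesis by (simp only: powr_add)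
      qed
      also have "M powr ((2 - q) / q) \<le> (n powr (-1/2)) powr ((2 - q) / q)"
        using True M q by (intro powr_mono2) auto
      also have "\<dots> = n powr (- ((2 - q) / (2 * q)))" by (simp add: powr_powr)
      also have "\<dots> \<le> n powr (- ((2 - q) / 4))"
        using n q by (intro powr_mono le_imp_neg_le divide_left_mono) auto
      also have "\<dots> = exp (- x / 4)" using n unfolding powr_def x_def by simp
      finally show ?thesis using M by (simp add: mult_left_mono)
    qed simp
    have "(5::real) \<le> exp 2" using exp_lower_Taylor_quadratic[of 2] by simp
    then have "5 powr K \<le> exp 2 powr K" using K by (intro powr_mono2) auto
    also have "\<dots> = exp (x / 8)" unfolding K_def by (simp add: powr_def)
    finally have "5 powr K * (n * M powr (2/q)) \<le> exp (x / 8) * (n * (M * exp (- x / 4)))"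
      using gain n by (intro mult_mono mult_left_mono) auto
    also have "\<dots> = n * M * exp (- x / 8)"
      by (simp flip: exp_add add: mult_ac)
    also have "\<dots> \<le> n * M * (8 / x)"
    proof -
      have "x / 8 \<le> exp (x / 8)" using exp_ge_add_one_self[of "x / 8"] by linarith
      then have "exp (- x / 8) \<le> 8 / x" using x by (simp add: exp_minus field_simps)
      then show ?thesis using n M by (intro mult_left_mono) auto
    qed
    finally have "V \<le> n * M * (8 / x) + n * M / K" using bound[OF K] by linarith
    also have "\<dots> = 24 * (n * M) / x" unfolding K_def using x by (simp add: field_simps)
    finally have "x * V \<le> 24 * (n * M)" using x by (simp add: field_simps)
    then show ?thesis using n unfolding x_def by (simp add: field_simps)
  qed
qed

text \<open>Weights up to \<open>K\<close> are paid for by the first term, weights above \<open>K\<close> by the second.\<close>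

lemma spectral_split:
  assumes K: "0 < K"
  shows "(if k = 0 then 0 else 1 :: real) \<le> 5 powr K * (real k * (1/5) ^ k) + 1 / K * (real k * 1)"
proof (cases "k = 0 \<or> K < real k")
  case True
  have "(if k = 0 then 0 else 1 :: real) \<le> 1 / K * (real k * 1)"
    using True K by (auto simp: field_simps)
  also have "\<dots> \<le> 5 powr K * (real k * (1/5) ^ k) + 1 / K * (real k * 1)" by simp
  finally show ?thesis .
next
  case False
  have "5 powr K * (1/5) ^ k = 5 powr (K - real k)"
    by (simp add: powr_diff powr_realpow power_one_over)
  also have "\<dots> \<ge> 1" using False by (intro ge_one_powr_ge_zero) auto
  finally have "1 * 1 \<le> (5 powr K * (1/5) ^ k) * real k"
    using False by (intro mult_mono) auto
  then have "(if k = 0 then 0 else 1 :: real) \<le> 5 powr K * (real k * (1/5) ^ k)"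
    using False by (simp add: mult_ac)
  also have "\<dots> \<le> 5 powr K * (real k * (1/5) ^ k) + 1 / K * (real k * 1)" using K by simp
  finally show ?thesis .
qed

text \<open>One eigenbasis that computes all norms and the variance at once.\<close>

lemma matrix_eigensystem:
  assumes A: "A \<in> carrier_mat (2^n) (2^n)" and h: "herm n (\<lambda>i j. A $$ (i, j))"
  obtains u d where "eigensystem n u d (\<lambda>i j. A $$ (i, j))"
    "\<And>p. 0 < p \<Longrightarrow> Lp_norm p A powr p = (\<Sum>k<2^n. \<bar>d k\<bar> powr p) / 2^n"
    "mat_var A = frob n (\<lambda>i j. A $$ (i, j)) - (cmod (entries_tr n (\<lambda>i j. A $$ (i, j))))\<^sup>2"
proof -
  have "mat_adjoint A = A"
    using A hermD[OF h] by (intro eq_matI) auto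
  then obtain U d where ud: "unitarily_diagonalizes U d A"
    using hermitian_spectral[OF A] by blast
  note e = diagonalized_eigensystem[OF ud A]
  have "ntr A = entries_tr n (\<lambda>i j. A $$ (i, j))"
    using A unfolding ntr_def entries_tr_def by simp
  then have "mat_var A = frob n (\<lambda>i j. A $$ (i, j)) - (cmod (entries_tr n (\<lambda>i j. A $$ (i, j))))\<^sup>2"
    using diagonalized_mat_var[OF ud] A unfolding frob_eigensystem[OF e] by simp
  then show ?thesis
    using that[OF e] diagonalized_Lp_norm[OF ud] A by simp
qed

lemma sum_powr_antimono:
  fixes d :: "nat \<Rightarrow> real"
  assumes "\<And>k. k < N \<Longrightarrow> \<bar>d k\<bar> \<le> 1" "p \<le> q"
  shows "(\<Sum>k<N. \<bar>d k\<bar> powr q) \<le> (\<Sum>k<N. \<bar>d k\<bar> powr p)"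
  using assms by (intro sum_mono powr_mono') auto

lemma partial_d_bounds:
  assumes T: "T \<in> carrier_mat (2^n) (2^n)" and c: "effect n (\<lambda>r s. T $$ (r, s))"
    and j: "1 \<le> j" "j \<le> n" and p: "1 \<le> p" and q: "p \<le> q" "4/3 \<le> q" "q \<le> 2"
    and M: "Lp_norm p (partial_d n j T) powr p \<le> M"
  defines "f \<equiv> bit_deriv (n - j) (\<lambda>r s. T $$ (r, s))"
  shows "energy n (\<lambda>k. (1/5) ^ k) f \<le> M powr (2/q)" "frob n f \<le> M"
proof -
  define A where "A = partial_d n j T"
  define g where "g = (\<lambda>r s. A $$ (r, s))"
  have A: "A \<in> carrier_mat (2^n) (2^n)" unfolding A_def by (rule partial_d_carrier[OF j])
  have gf: "g r s = f r s" if "r < 2^n" "s < 2^n" for r s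
    unfolding g_def A_def f_def by (rule partial_d_index[OF j that])
  have m: "n - j < n" using j by simp
  have hf: "herm n f" unfolding f_def by (rule herm_bit_deriv[OF effect_herm[OF c] m])
  then have hg: "herm n g" by (intro hermI) (simp add: gf hermD)
  obtain u d where e: "eigensystem n u d g"
    and Lp: "\<And>p. 0 < p \<Longrightarrow> Lp_norm p A powr p = (\<Sum>k<2^n. \<bar>d k\<bar> powr p) / 2^n"
    using matrix_eigensystem[OF A hg[unfolded g_def]] unfolding g_def by blast
  have e: "eigensystem n u d f" using e gf unfolding eigensystem_def by simp
  have d: "\<bar>d k\<bar> \<le> 1" if "k < 2^n" for k
    using norm_qform_bit_deriv_le[OF c m] unfolding f_def[symmetric] by (rule eigenvalue_bound[OF e that])
  have q_le: "(\<Sum>k<2^n. \<bar>d k\<bar> powr q) / 2^n \<le> M"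
  proof -
    have "(\<Sum>k<2^n. \<bar>d k\<bar> powr q) / 2^n \<le> (\<Sum>k<2^n. \<bar>d k\<bar> powr p) / 2^n"
      using d q by (intro divide_right_mono sum_powr_antimono) auto
    also have "\<dots> \<le> M" using M Lp[of p] p unfolding A_def by simp
    finally show ?thesis .
  qed
  have "energy n (\<lambda>k. (1/5) ^ k) f \<le> ((\<Sum>k<2^n. \<bar>d k\<bar> powr q) / 2^n) powr (2/q)"
    by (rule energy_le_Lq[OF e hf q(2)])
  also have "\<dots> \<le> M powr (2/q)"
    using q_le q by (intro powr_mono2) (auto intro!: divide_nonneg_nonneg sum_nonneg)
  finally show "energy n (\<lambda>k. (1/5) ^ k) f \<le> M powr (2/q)" .
  have "(\<Sum>k<2^n. (d k)\<^sup>2) \<le> (\<Sum>k<2^n. \<bar>d k\<bar> powr q)"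
    using sum_powr_antimono[of "2^n" d q 2] d q by simp
  then show "frob n f \<le> M"
    using q_le unfolding frob_eigensystem[OF e] by (meson divide_right_mono order_trans zero_le_numeral zero_le_power)
qed

text \<open>The weight inequality \<open>spectral_split\<close>, integrated against the energy of \<open>T\<close>, becomes through
  \<open>sum_energy_bit_deriv\<close> a bound of the variance by the energies and 2-norms of the derivatives. The
  constant \<open>1/36\<close> is \<open>1/24\<close> times the loss \<open>2/3\<close> in passing from \<open>2 - p\<close> to \<open>2 - q\<close>.\<close>

lemma variance_bound:
  fixes T :: "complex mat"
  assumes n: "2 \<le> n" and p: "1 \<le> p" "p < 2" and T: "T \<in> carrier_mat (2^n) (2^n)"
    and c: "effect n (\<lambda>r s. T $$ (r, s))"
    and M: "\<And>j. j \<in> {1..n} \<Longrightarrow> Lp_norm p (partial_d n j T) powr p \<le> M"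
  shows "1/36 * ((2 - p) * mat_var T * ln (real n) / real n) \<le> M"
proof -
  define q where "q = max p (4/3)"
  have q: "p \<le> q" "4/3 \<le> q" "q < 2" "2/3 * (2 - p) \<le> 2 - q"
    using p unfolding q_def by auto
  define f where "f = (\<lambda>r s. T $$ (r, s))"
  have hf: "herm n f" unfolding f_def by (rule effect_herm[OF c])
  obtain u d where e: "eigensystem n u d f"
    and var: "mat_var T = frob n f - (cmod (entries_tr n f))\<^sup>2"
    using matrix_eigensystem[OF T hf[unfolded f_def]] unfolding f_def by blast
  have "frob n f \<le> 1"
  proof -
    have "(\<Sum>k<2^n. (d k)\<^sup>2) \<le> (\<Sum>k<(2::nat)^n. 1)"
      using eigenvalue_bound[OF e _ effect_norm_qform[OF c[folded f_def]]]
      by (intro sum_mono) (simp add: abs_square_le_1)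
    then show ?thesis unfolding frob_eigensystem[OF e] by simp
  qed
  then have V1: "mat_var T \<le> 1" unfolding var using zero_le_power2[of "cmod (entries_tr n f)"] by linarith
  have V: "mat_var T = energy n (\<lambda>k. if k = 0 then 0 else 1) f"
  proof -
    have "energy n (\<lambda>_. 1) f = energy n (\<lambda>k. (if k = 0 then 1 else 0) + (if k = 0 then 0 else 1)) f"
      by (rule arg_cong[where f = "\<lambda>\<phi>. energy n \<phi> f"]) auto
    then show ?thesis unfolding var energy_add energy_one energy_trace by simp
  qed
  have V0: "0 \<le> mat_var T" unfolding V by (rule energy_nonneg) simp
  have M': "energy n (\<lambda>k. (1/5) ^ k) (bit_deriv m f) \<le> M powr (2/q)" "frob n (bit_deriv m f) \<le> M" if "m < n" for m
    using partial_d_bounds[OF T c, of "n - m" p q M] M[of "n - m"] that p q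
    unfolding f_def by auto
  have M0: "0 \<le> M" using M'(2)[of 0] n frob_nonneg[of n "bit_deriv 0 f"] by linarith
  have bound: "mat_var T \<le> 5 powr K * (real n * M powr (2/q)) + real n * M / K" if K: "0 < K" for K
  proof -
    have "mat_var T \<le> energy n (\<lambda>k. 5 powr K * (real k * (1/5) ^ k) + 1 / K * (real k * 1)) f"
      unfolding V by (rule energy_mono) (rule spectral_split[OF K])
    also have "\<dots> = 5 powr K * (\<Sum>m<n. energy n (\<lambda>k. (1/5) ^ k) (bit_deriv m f))
        + 1 / K * (\<Sum>m<n. frob n (bit_deriv m f))"
      unfolding energy_add energy_scale sum_energy_bit_deriv[symmetric] energy_one ..
    also have "\<dots> \<le> 5 powr K * (\<Sum>m<n. M powr (2/q)) + 1 / K * (\<Sum>m<n. M)"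
      using K by (intro add_mono mult_left_mono sum_mono M') auto
    finally show ?thesis by simp
  qed
  have "(2 - q) * mat_var T * ln (real n) / real n \<le> 24 * M"
    using n q V0 V1 M0 bound by (intro dichotomy_bound) auto
  moreover have "0 \<le> mat_var T * ln (real n) / real n" using V0 n by simp
  then have "2/3 * ((2 - p) * mat_var T * ln (real n) / real n) \<le>
      (2 - q) * mat_var T * ln (real n) / real n"
    using mult_right_mono[OF q(4), of "mat_var T * ln (real n) / real n"]
    by (simp only: mult.assoc times_divide_eq_right)
  ultimately show ?thesis by linarith
qed

theorem theorem1p9:
  shows "\<exists>C::real. C > 0 \<and>
    (\<forall>(n::nat) (p::real) (T::complex mat).
       n \<ge> 1 \<longrightarrow> 1 \<le> p \<longrightarrow> p < 2 \<longrightarrow> T \<in> carrier_mat (2 ^ n) (2 ^ n) \<longrightarrow>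
       loewner_le (0\<^sub>m (2 ^ n) (2 ^ n)) T \<longrightarrow> loewner_le T (1\<^sub>m (2 ^ n)) \<longrightarrow>
       Max ((\<lambda>j. Lp_norm p (partial_d n j T) powr p) ` {1..n})
         \<ge> C * ((2 - p) * mat_var T * ln (real n) / real n))"
proof (intro exI[of _ "1/36"] conjI allI impI)
  fix n :: nat and p :: real and T :: "complex mat"
  assume n: "n \<ge> 1" and p: "1 \<le> p" "p < 2" and T: "T \<in> carrier_mat (2 ^ n) (2 ^ n)"
    and le: "loewner_le (0\<^sub>m (2 ^ n) (2 ^ n)) T" "loewner_le T (1\<^sub>m (2 ^ n))"
  define M where "M = Max ((\<lambda>j. Lp_norm p (partial_d n j T) powr p) ` {1..n})"
  have M: "Lp_norm p (partial_d n j T) powr p \<le> M" if "j \<in> {1..n}" for j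
    unfolding M_def using that by (intro Max_ge) auto
  show "1/36 * ((2 - p) * mat_var T * ln (real n) / real n) \<le> M"
  \<comment> \<open>for \<open>n = 1\<close> the logarithm vanishes\<close>
  proof (cases "n = 1")
    case True
    have "0 \<le> Lp_norm p (partial_d n 1 T) powr p" by simp
    also have "\<dots> \<le> M" using M n by simp
    finally show ?thesis using True by simp
  next
    case False
    then show ?thesis
      using n p T M loewner_effect[OF T le] by (intro variance_bound) auto
  qed
qed simp

end
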